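(* Suppose there is a language $L \in \mathrm{NP}$ and a constant $\epsilon > 0$ such that for all but finitely many $n$, $CC(L_n) > 2^{n^{\epsilon}}$. Then every $\mathrm{NP}$-complete language $A$ is complete for $\mathrm{NP}$ via length-increasing $\mathrm{P/poly}$ reductions; that is, for every $B \in \mathrm{NP}$ there is a function $f$ computable by a polynomial-size circuit family (equivalently, in polynomial time with polynomial-length advice depending only on the input length) such that for all $x$, $x \in B \iff f(x) \in A$, and $|f(x)| > |x|$.
   Context: Languages are over $\Sigma=\{0,1\}$. For a language $L$, $L_n$ denotes the Boolean function $\Sigma^n \to \Sigma$ given by the characteristic function of $L$ restricted to strings of length $n$. For a Boolean function $g:\Sigma^n\to\Sigma$, $CC(g)$ is the smallest $s$ such that some Boolean circuit of size $s$ computes $g$. "$\mathrm{NP}$-complete" means complete under polynomial-time many-one reductions. *)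

theory Defs
  imports Complex_Main
begin

type_synonym lang = "bool list set"

datatype move = MoveL | MoveR | MoveS

text \<open>A machine has finitely many states (0 = start, 1 = halt) and finitely many tape
  symbols (0 = blank, 1 = bit 0, 2 = bit 1).\<close>
record tm =
  tm_states  :: nat
  tm_symbols :: nat
  tm_delta   :: "nat \<Rightarrow> nat \<Rightarrow> nat \<times> nat \<times> move"

definition wf_tm :: "tm \<Rightarrow> bool" where
  "wf_tm M \<longleftrightarrow> tm_states M \<ge> 2 \<and> tm_symbols M \<ge> 3 \<and>
     (\<forall>q < tm_states M. \<forall>a < tm_symbols M.
        fst (tm_delta M q a) < tm_states M \<and> fst (snd (tm_delta M q a)) < tm_symbols M)"

text \<open>Configuration: (state, tape left of head in reverse order, tape from head rightwards).\<close>
type_synonym config = "nat \<times> nat list \<times> nat list"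

definition tm_step :: "tm \<Rightarrow> config \<Rightarrow> config" where
  "tm_step M c = (case c of (q, l, r) \<Rightarrow>
     if q = 1 then (q, l, r) else
     (let a = (case r of [] \<Rightarrow> 0 | x # _ \<Rightarrow> x);
          (q', b, m) = tm_delta M q a;
          r' = b # tl r
      in case m of
           MoveS \<Rightarrow> (q', l, r')
         | MoveR \<Rightarrow> (q', b # l, tl r)
         | MoveL \<Rightarrow> (case l of [] \<Rightarrow> (q', [], r') | y # l' \<Rightarrow> (q', l', y # r'))))"

definition enc_bit :: "bool \<Rightarrow> nat" where
  "enc_bit b = (if b then 2 else 1)"

definition tm_init :: "bool list \<Rightarrow> config" where
  "tm_init x = (0, [], map enc_bit x)"

definition tm_output :: "config \<Rightarrow> bool list" where
  "tm_output c = map (\<lambda>a. a = 2) (takeWhile (\<lambda>a. a = 1 \<or> a = 2) (snd (snd c)))"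

definition halts_with :: "tm \<Rightarrow> bool list \<Rightarrow> nat \<Rightarrow> bool list \<Rightarrow> bool" where
  "halts_with M x t y \<longleftrightarrow>
     fst ((tm_step M ^^ t) (tm_init x)) = 1 \<and> tm_output ((tm_step M ^^ t) (tm_init x)) = y"

definition poly_time_computable :: "(bool list \<Rightarrow> bool list) \<Rightarrow> bool" where
  "poly_time_computable f \<longleftrightarrow>
     (\<exists>M c k. wf_tm M \<and>
        (\<forall>x. \<exists>t. t \<le> c * length x ^ k + c \<and> halts_with M x t (f x)))"

definition in_P :: "lang \<Rightarrow> bool" where
  "in_P L \<longleftrightarrow> poly_time_computable (\<lambda>x. [x \<in> L])"

definition pair_enc :: "bool list \<Rightarrow> bool list \<Rightarrow> bool list" where
  "pair_enc x w = concat (map (\<lambda>b. [b, b]) x) @ [False, True] @ w"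

definition in_NP :: "lang \<Rightarrow> bool" where
  "in_NP L \<longleftrightarrow> (\<exists>V c k. in_P V \<and>
     (\<forall>x. x \<in> L \<longleftrightarrow> (\<exists>w. length w \<le> c * length x ^ k + c \<and> pair_enc x w \<in> V)))"

definition NP_complete :: "lang \<Rightarrow> bool" where
  "NP_complete A \<longleftrightarrow> in_NP A \<and>
     (\<forall>B. in_NP B \<longrightarrow> (\<exists>f. poly_time_computable f \<and> (\<forall>x. x \<in> B \<longleftrightarrow> f x \<in> A)))"

text \<open>Functions computable in polynomial time with polynomial-length advice depending only
  on the input length (FP/poly, equivalently polynomial-size circuit families).\<close>
definition P_poly_computable :: "(bool list \<Rightarrow> bool list) \<Rightarrow> bool" where
  "P_poly_computable f \<longleftrightarrow>
     (\<exists>M c k (a :: nat \<Rightarrow> bool list). wf_tm M \<and>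
        (\<forall>n. length (a n) \<le> c * n ^ k + c) \<and>
        (\<forall>x. \<exists>t. t \<le> c * length x ^ k + c \<and>
               halts_with M (pair_enc x (a (length x))) t (f x)))"

text \<open>Wires 0..n-1 are the inputs; gate i (0-based) defines wire n+i and may only read
  earlier wires. Size = number of gates (fan-in at most 2).\<close>
datatype gate = GConst bool | GNot nat | GAnd nat nat | GOr nat nat

fun gate_refs :: "gate \<Rightarrow> nat set" where
  "gate_refs (GConst b) = {}"
| "gate_refs (GNot i) = {i}"
| "gate_refs (GAnd i j) = {i, j}"
| "gate_refs (GOr i j) = {i, j}"

fun gate_val :: "bool list \<Rightarrow> gate \<Rightarrow> bool" where
  "gate_val vs (GConst b) = b"
| "gate_val vs (GNot i) = (\<not> vs ! i)"
| "gate_val vs (GAnd i j) = (vs ! i \<and> vs ! j)"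
| "gate_val vs (GOr i j) = (vs ! i \<or> vs ! j)"

fun eval_gates :: "bool list \<Rightarrow> gate list \<Rightarrow> bool list" where
  "eval_gates vs [] = vs"
| "eval_gates vs (g # gs) = eval_gates (vs @ [gate_val vs g]) gs"

text \<open>A circuit with n inputs: a gate list and an output wire.\<close>
type_synonym circuit = "gate list \<times> nat"

definition wf_circuit :: "nat \<Rightarrow> circuit \<Rightarrow> bool" where
  "wf_circuit n C \<longleftrightarrow> (\<forall>i < length (fst C). gate_refs (fst C ! i) \<subseteq> {..< n + i})
     \<and> snd C < n + length (fst C)"

definition circuit_eval :: "circuit \<Rightarrow> bool list \<Rightarrow> bool" where
  "circuit_eval C xs = eval_gates xs (fst C) ! snd C"

definition circuit_size :: "circuit \<Rightarrow> nat" where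
  "circuit_size C = length (fst C)"

definition circuit_computes :: "nat \<Rightarrow> circuit \<Rightarrow> (bool list \<Rightarrow> bool) \<Rightarrow> bool" where
  "circuit_computes n C g \<longleftrightarrow> wf_circuit n C \<and>
     (\<forall>xs. length xs = n \<longrightarrow> circuit_eval C xs = g xs)"

definition CC :: "nat \<Rightarrow> (bool list \<Rightarrow> bool) \<Rightarrow> nat" where
  "CC n g = (LEAST s. \<exists>C. circuit_computes n C g \<and> circuit_size C = s)"

text \<open>L_n: characteristic function of L (used on strings of length n).\<close>
definition lang_slice :: "lang \<Rightarrow> nat \<Rightarrow> bool list \<Rightarrow> bool" where
  "lang_slice L n = (\<lambda>xs. xs \<in> L)"

end

theory Submission
  imports Defs
begin

text \<open>Let \<open>C\<close> be the NP language of triples \<open>(y, x, z)\<close> with \<open>(y \<in> B \<and> x \<in> L) \<or> z \<in> L\<close> and let \<open>f\<close> reduce \<open>C\<close>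
  to \<open>A\<close>. If \<open>x \<in> L\<close> and \<open>z \<notin> L\<close>, then \<open>y \<in> B\<close> iff \<open>f (y, x, z) \<in> A\<close>, so it suffices to find, for every
  length \<open>n\<close> of \<open>y\<close>, such a pair \<open>x, z\<close> of polynomial length for which all these images are longer than \<open>n\<close>;
  the pair is the advice, and the machine computing \<open>f\<close> is used unchanged.

  A short image outside \<open>A\<close> of some \<open>(y, x, z)\<close> with \<open>x \<in> L\<close>, \<open>y \<notin> B\<close> certifies \<open>z \<notin> L\<close>. If every
  \<open>z \<notin> L\<close> had such a certificate, then circuits enumerating all \<open>x, y\<close> and all short strings would decide \<open>L\<close>
  at the length of \<open>z\<close>; they are too small because \<open>z\<close> is chosen polynomially longer than \<open>x\<close>. So some
  \<open>z \<notin> L\<close> has no certificate, and then the images are long for all \<open>x \<in> L\<close>, \<open>y \<notin> B\<close>. For this fixed \<open>z\<close>,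
  a short image in \<open>A\<close> with \<open>y \<in> B\<close> certifies \<open>x \<in> L\<close>, and the same argument one level down, with \<open>x\<close>
  polynomially longer than \<open>y\<close>, yields \<open>x\<close>.\<close>

section \<open>Tapes as functions and generic machines\<close>

text \<open>Two guard strings are needed because short images must be excluded on both sides of
  \<open>A\<close>: \<open>z\<close> guards the images of \<open>y \<notin> B\<close>,
  \<open>x\<close> those of \<open>y \<in> B\<close>. The guard \<open>z\<close> is fixed against
  all \<open>x \<in> L\<close> at once, since \<open>x\<close> is chosen later and depends on
  \<open>z\<close>; the search refuting a bad \<open>z\<close> therefore runs over the
  \<open>x\<close> too, which is why \<open>z\<close> must be longer. A search over strings of
  length at most \<open>r\<close> costs \<open>2 ^ O(r)\<close> gates, while
  \<open>2 ^ r\<^sup>2\<close> are allowed at input length \<open>r ^ k\<close> with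
  \<open>k \<ge> 2 / \<epsilon>\<close>. Nothing is known about the complexity of \<open>A\<close>,
  but it has only \<open>2 ^ O(r)\<close> strings of length at most \<open>r\<close>, so these are
  hardwired. The machine for \<open>f\<close> can stay unchanged because fields are nested by
  \<open>pair_enc\<close>: an instance with first field \<open>y\<close> is literally
  \<open>y\<close> paired with an advice string. Most of the work is to place the triple language in
  NP for concrete one-tape machines. The only composition used is branching on a decidable property
  of a subsequence that a finite automaton extracts from the input.\<close>

type_synonym ('q, 's) fconf = "'q \<times> nat \<times> (nat \<Rightarrow> 's)"

text \<open>Truncated subtraction keeps the head on cell 0, as \<open>tm_step\<close> does when
  nothing lies to the left.\<close>

fun shift :: "move \<Rightarrow> nat \<Rightarrow> nat" where
  "shift MoveL h = h - 1"
| "shift MoveR h = Suc h"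
| "shift MoveS h = h"

fun fstep :: "('q \<Rightarrow> 's \<Rightarrow> 'q \<times> 's \<times> move) \<Rightarrow> 'q \<Rightarrow> ('q, 's) fconf \<Rightarrow> ('q, 's) fconf" where
  "fstep \<delta> qh (q, h, f) = (if q = qh then (q, h, f)
     else (case \<delta> q (f h) of (q', b, m) \<Rightarrow> (q', shift m h, f(h := b))))"

text \<open>The default 0 is the blank, so lists that differ only in trailing blanks give the same
  tape.\<close>

definition tape :: "nat list \<Rightarrow> nat \<Rightarrow> nat" where
  "tape xs i = (if i < length xs then xs ! i else 0)"

fun abs_conf :: "config \<Rightarrow> (nat, nat) fconf" where
  "abs_conf (q, l, r) = (q, length l, tape (rev l @ r))"

definition gtape :: "'s \<Rightarrow> 's \<Rightarrow> 's \<Rightarrow> bool list \<Rightarrow> nat \<Rightarrow> 's" where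
  "gtape z s0 s1 x i = (if i < length x then if x ! i then s1 else s0 else z)"

lemma tape_upd: "tape (rev l @ r) (length l) = (case r of [] \<Rightarrow> 0 | x # _ \<Rightarrow> x)"
  "(tape (rev l @ r)) (length l := b) = tape (rev l @ b # tl r)"
  by (cases r; auto simp: tape_def fun_eq_iff nth_append nth_Cons')+

lemma abs_conf_step: "abs_conf (tm_step M c) = fstep (tm_delta M) 1 (abs_conf c)"
proof -
  obtain q l r where c: "c = (q, l, r)" by (cases c) auto
  show ?thesis
  proof (cases "q = 1")
    case True then show ?thesis by (simp add: c tm_step_def)
  next
    case False
    obtain q' b m where d: "tm_delta M q (case r of [] \<Rightarrow> 0 | x # _ \<Rightarrow> x) = (q', b, m)"
      by (metis prod_cases3)
    have e: "fstep (tm_delta M) 1 (abs_conf c) =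
        (q', shift m (length l), tape (rev l @ b # tl r))"
      using False d by (simp add: c tape_upd del: fun_upd_apply)
    show ?thesis unfolding e using False d
      by (cases m) (auto simp: c tm_step_def Let_def split: list.split)
  qed
qed

lemma abs_conf_steps: "abs_conf ((tm_step M ^^ t) c) = (fstep (tm_delta M) 1 ^^ t) (abs_conf c)"
  by (induction t) (auto simp: abs_conf_step)

lemma abs_conf_init: "abs_conf (tm_init x) = (0, 0, gtape 0 1 2 x)"
  by (auto simp: tm_init_def tape_def gtape_def enc_bit_def fun_eq_iff)

text \<open>\<open>tm_output\<close> without lists: the last two conditions say that
  \<open>takeWhile\<close> stops right after \<open>y\<close>. In this form a circuit can check it
  cell by cell.\<close>

fun fout :: "('q, nat) fconf \<Rightarrow> bool list \<Rightarrow> bool" where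
  "fout (q, h, f) y \<longleftrightarrow> (\<forall>i < length y. f (h + i) = enc_bit (y ! i)) \<and>
     f (h + length y) \<noteq> 1 \<and> f (h + length y) \<noteq> 2"

lemma output_iff_aux:
  "map (\<lambda>a. a = 2) (takeWhile (\<lambda>a. a = 1 \<or> a = 2) r) = y \<longleftrightarrow>
    (\<forall>i < length y. tape r i = enc_bit (y ! i)) \<and> tape r (length y) \<noteq> 1 \<and> tape r (length y) \<noteq> 2"
proof (induction r arbitrary: y)
  case Nil
  show ?case by (cases y) (auto simp: tape_def enc_bit_def)
next
  case (Cons a r)
  have tape0: "tape (a # r) 0 = a" and tapeS: "\<And>i. tape (a # r) (Suc i) = tape r i"
    by (auto simp: tape_def)
  show ?case
  proof (cases y)
    case Nil then show ?thesis by (auto simp: tape0)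
  next
    case (Cons b y')
    have "map (\<lambda>a. a = 2) (takeWhile (\<lambda>a. a = 1 \<or> a = 2) (a # r)) = y \<longleftrightarrow>
       a = enc_bit b \<and> map (\<lambda>a. a = 2) (takeWhile (\<lambda>a. a = 1 \<or> a = 2) r) = y'"
      by (auto simp: Cons enc_bit_def)
    then show ?thesis unfolding Cons.IH
      by (simp add: Cons tape0 tapeS All_less_Suc2)
  qed
qed

lemma tm_output_iff: "tm_output c = y \<longleftrightarrow> fout (abs_conf c) y"
proof -
  obtain q l r where c: "c = (q, l, r)" by (cases c) auto
  have "tape (rev l @ r) (length l + i) = tape r i" for i
    by (auto simp: tape_def nth_append)
  then show ?thesis unfolding tm_output_def c using output_iff_aux[of r y] by simp
qed

lemma halts_with_iff:
  "halts_with M x t y \<longleftrightarrow> (\<exists>h f. (fstep (tm_delta M) 1 ^^ t) (0, 0, gtape 0 1 2 x) = (1, h, f)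
     \<and> fout (1::nat, h, f) y)"
proof -
  let ?c = "(tm_step M ^^ t) (tm_init x)"
  have a: "abs_conf ?c = (fstep (tm_delta M) 1 ^^ t) (0, 0, gtape 0 1 2 x)"
    by (simp add: abs_conf_steps abs_conf_init)
  obtain q l r where c: "?c = (q, l, r)" by (cases ?c) auto
  have "abs_conf ?c = (q, length l, tape (rev l @ r))" by (simp add: c)
  then show ?thesis unfolding halts_with_def tm_output_iff a[symmetric] by (auto simp: c)
qed

lemma fstep_halted: "(fstep \<delta> qh ^^ t) (qh, h, f) = (qh, h, f)"
  by (induction t) auto

text \<open>Allows a circuit to simulate the same number of steps on all inputs of one length,
  although the halting times differ.\<close>

lemma fstep_halted_later:
  assumes "(fstep \<delta> qh ^^ t) c = (qh, h, f)" "t \<le> t'"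
  shows "(fstep \<delta> qh ^^ t') c = (qh, h, f)"
proof -
  obtain d where "t' = d + t" using assms(2) by (metis le_add_diff_inverse2)
  then show ?thesis using assms(1) by (simp add: funpow_add fstep_halted)
qed

section \<open>Polynomially bounded functions\<close>

definition polybd :: "(nat \<Rightarrow> nat) \<Rightarrow> bool" where
  "polybd p \<longleftrightarrow> (\<exists>c k. \<forall>n. p n \<le> c * n ^ k + c)"

text \<open>With a base that is at least 1, powers grow with the exponent and no additive constant
  is left; sums and products of bounds then only require adding exponents.\<close>

lemma polybd_Suc: "polybd p \<longleftrightarrow> (\<exists>c k. \<forall>n. p n \<le> c * Suc n ^ k)"
proof
  assume "polybd p"
  then obtain c k where p: "\<And>n. p n \<le> c * n ^ k + c" unfolding polybd_def by blast
  have "p n \<le> (2 * c) * Suc n ^ k" for n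
  proof -
    have "n ^ k \<le> Suc n ^ k" "1 \<le> Suc n ^ k" by (auto intro: power_mono)
    then have "c * n ^ k + c \<le> c * Suc n ^ k + c * Suc n ^ k"
      using mult_le_mono2[of "n ^ k" "Suc n ^ k" c] mult_le_mono2[of 1 "Suc n ^ k" c] by linarith
    then show ?thesis using p[of n] by (simp add: mult_2 distrib_right)
  qed
  then show "\<exists>c k. \<forall>n. p n \<le> c * Suc n ^ k" by blast
next
  assume "\<exists>c k. \<forall>n. p n \<le> c * Suc n ^ k"
  then obtain c k where p: "\<And>n. p n \<le> c * Suc n ^ k" by blast
  have "p n \<le> (c * 2 ^ k) * n ^ k + c * 2 ^ k" for n
  proof (cases "n = 0")
    case True
    have "p 0 \<le> c" using p[of 0] by simp
    also have "c \<le> c * 2 ^ k" by simp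
    finally show ?thesis using True by simp
  next
    case False
    have "Suc n ^ k \<le> (2 * n) ^ k" using False by (intro power_mono) auto
    then have "c * Suc n ^ k \<le> c * (2 ^ k * n ^ k)"
      by (intro mult_le_mono) (simp_all only: power_mult_distrib order_refl)
    then show ?thesis using le_trans[OF p[of n]] by (simp add: mult.assoc trans_le_add1)
  qed
  then show "polybd p" unfolding polybd_def by blast
qed

lemma polybd_const [intro, simp]: "polybd (\<lambda>n. c)"
  unfolding polybd_def by (rule exI[of _ c], rule exI[of _ 0]) simp

lemma polybd_id [intro, simp]: "polybd (\<lambda>n. n)"
  unfolding polybd_def by (rule exI[of _ 1], rule exI[of _ 1]) simp

lemma polybd_mult [intro, simp]:
  assumes "polybd p" "polybd q" shows "polybd (\<lambda>n. p n * q n)"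
proof -
  obtain c k where "\<And>n. p n \<le> c * Suc n ^ k" using assms(1) unfolding polybd_Suc by blast
  moreover obtain d l where "\<And>n. q n \<le> d * Suc n ^ l" using assms(2) unfolding polybd_Suc by blast
  ultimately have "p n * q n \<le> (c * Suc n ^ k) * (d * Suc n ^ l)" for n by (rule mult_le_mono)
  then have "p n * q n \<le> (c * d) * Suc n ^ (k + l)" for n
    by (simp add: power_add mult_ac)
  then show ?thesis unfolding polybd_Suc by blast
qed

lemma polybd_add [intro, simp]:
  assumes "polybd p" "polybd q" shows "polybd (\<lambda>n. p n + q n)"
proof -
  obtain c k where p: "\<And>n. p n \<le> c * Suc n ^ k" using assms(1) unfolding polybd_Suc by blast
  obtain d l where q: "\<And>n. q n \<le> d * Suc n ^ l" using assms(2) unfolding polybd_Suc by blast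
  have "p n + q n \<le> (c + d) * Suc n ^ (k + l)" for n
  proof -
    have "c * Suc n ^ k \<le> c * Suc n ^ (k + l)" "d * Suc n ^ l \<le> d * Suc n ^ (k + l)"
      by (intro mult_le_mono order_refl power_increasing; simp)+
    then show ?thesis using p[of n] q[of n] unfolding distrib_right by linarith
  qed
  then show ?thesis unfolding polybd_Suc by blast
qed

lemma polybd_Suc_fun [intro, simp]: "polybd p \<Longrightarrow> polybd (\<lambda>n. Suc (p n))"
  using polybd_add[of p "\<lambda>_. 1"] by simp

lemma polybd_power [intro, simp]: "polybd p \<Longrightarrow> polybd (\<lambda>n. p n ^ k)"
  by (induction k) auto

lemma polybd_sum2: "polybd (\<lambda>n. c * n ^ k + c)"
  by auto

section \<open>Machines over arbitrary finite sets of states and symbols\<close>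

definition index_of :: "'a list \<Rightarrow> 'a \<Rightarrow> nat" where
  "index_of xs x = (LEAST i. xs ! i = x)"

lemma index_of_nth:
  assumes "distinct xs" "i < length xs" shows "index_of xs (xs ! i) = i"
  unfolding index_of_def
proof (rule Least_equality)
  fix j assume "xs ! j = xs ! i"
  then show "i \<le> j" using assms 
    by (cases "j < length xs") (auto simp: nth_eq_iff_index_eq)
qed simp

lemma index_of_in:
  assumes "distinct xs" "x \<in> set xs" shows "index_of xs x < length xs" "xs ! index_of xs x = x"
  using assms index_of_nth[of xs] by (auto simp: in_set_conv_nth)

text \<open>Lets machines be programmed over datatypes: the five distinguished states and symbols
  are listed first, so they receive the numbers that \<open>tm\<close> prescribes. The answer is
  read off one cell, and the conditions on \<open>Suc h\<close> make the output exactly one bit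
  long.\<close>

lemma in_P_generic:
  fixes \<delta> :: "'q \<Rightarrow> 's \<Rightarrow> 'q \<times> 's \<times> move"
  assumes fin: "finite Q" "finite S"
    and q: "q0 \<in> Q" "qh \<in> Q" "q0 \<noteq> qh"
    and s: "z \<in> S" "s0 \<in> S" "s1 \<in> S" "z \<noteq> s0" "z \<noteq> s1" "s0 \<noteq> s1"
    and closed: "\<And>q a. q \<in> Q \<Longrightarrow> q \<noteq> qh \<Longrightarrow> a \<in> S \<Longrightarrow> fst (\<delta> q a) \<in> Q \<and> fst (snd (\<delta> q a)) \<in> S"
    and p: "polybd p"
    and run: "\<And>x. \<exists>t \<le> p (length x). \<exists>h f. (fstep \<delta> qh ^^ t) (q0, 0, gtape z s0 s1 x) = (qh, h, f)
       \<and> f h = (if x \<in> V then s1 else s0) \<and> f (Suc h) \<noteq> s0 \<and> f (Suc h) \<noteq> s1"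
  shows "in_P V"
proof -
  obtain rq where rq: "set rq = Q - {q0, qh}" "distinct rq"
    using fin(1) by (meson finite_Diff finite_distinct_list)
  obtain rs where rs: "set rs = S - {z, s0, s1}" "distinct rs"
    using fin(2) by (meson finite_Diff finite_distinct_list)
  define lq where "lq = q0 # qh # rq"
  define ls where "ls = z # s0 # s1 # rs"
  have dq: "distinct lq" "set lq = Q" using rq q by (auto simp: lq_def)
  have ds: "distinct ls" "set ls = S" using rs s by (auto simp: ls_def)
  let ?eq = "index_of lq" and ?es = "index_of ls"
  \<comment> \<open>The default also covers the halting state, whose value \<open>closed\<close>
    leaves open but \<open>wf_tm\<close> wants in range.\<close>
  define d where "d = (\<lambda>q a. if q < length lq \<and> a < length ls \<and> q \<noteq> 1
     then (case \<delta> (lq ! q) (ls ! a) of (q', b, m) \<Rightarrow> (?eq q', ?es b, m)) else (0, 0, MoveS))"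
  define M where "M = \<lparr>tm_states = length lq, tm_symbols = length ls, tm_delta = d\<rparr>"
  have n0: "q0 = lq ! 0" "qh = lq ! 1" "z = ls ! 0" "s0 = ls ! 1" "s1 = ls ! 2"
    and l0: "0 < length lq" "1 < length lq" "0 < length ls" "1 < length ls" "2 < length ls"
    by (simp_all add: lq_def ls_def)
  have e0: "?eq q0 = 0" "?eq qh = 1" "?es z = 0" "?es s0 = 1" "?es s1 = 2"
    unfolding n0 by (intro index_of_nth dq ds l0)+
  have pq: "?eq q < length lq" "lq ! ?eq q = q" if "q \<in> Q" for q
    using index_of_in[OF dq(1)] that dq by auto
  have ps: "?es a < length ls" "ls ! ?es a = a" if "a \<in> S" for a
    using index_of_in[OF ds(1)] that ds by auto
  have wf: "wf_tm M"
    unfolding wf_tm_def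
  proof (intro conjI allI impI)
    show "2 \<le> tm_states M" "3 \<le> tm_symbols M" by (auto simp: M_def lq_def ls_def)
    fix q a assume qa: "q < tm_states M" "a < tm_symbols M"
    have "fst (d q a) < length lq \<and> fst (snd (d q a)) < length ls"
    proof (cases "q = 1")
      case True then show ?thesis by (auto simp: d_def lq_def ls_def)
    next
      case False
      have i: "q < length lq" "a < length ls" using qa by (auto simp: M_def)
      have "lq ! q \<noteq> qh" using False index_of_nth[OF dq(1) i(1)] e0 by metis
      then have "fst (\<delta> (lq ! q) (ls ! a)) \<in> Q" "fst (snd (\<delta> (lq ! q) (ls ! a))) \<in> S"
        using closed[of "lq ! q" "ls ! a"] nth_mem[OF i(1)] nth_mem[OF i(2)] dq(2) ds(2) by auto
      then show ?thesis using i False pq(1) ps(1)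
        by (auto simp: d_def split: prod.split)
    qed
    then show "fst (tm_delta M q a) < tm_states M" "fst (snd (tm_delta M q a)) < tm_symbols M"
      by (auto simp: M_def)
  qed
  have inv: "\<exists>q h f. (fstep \<delta> qh ^^ t) (q0, 0, gtape z s0 s1 x) = (q, h, f) \<and> q \<in> Q \<and> range f \<subseteq> S
       \<and> (fstep d 1 ^^ t) (0, 0, gtape 0 1 2 x) = (?eq q, h, ?es \<circ> f)" for t x
  proof (induction t)
    case 0
    have "range (gtape z s0 s1 x) \<subseteq> S" "gtape 0 1 2 x = ?es \<circ> gtape z s0 s1 x"
      using s e0 by (auto simp: gtape_def fun_eq_iff)
    then show ?case using q e0 by auto
  next
    case (Suc t)
    then obtain q h f where i: "(fstep \<delta> qh ^^ t) (q0, 0, gtape z s0 s1 x) = (q, h, f)" "q \<in> Q"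
      "range f \<subseteq> S" "(fstep d 1 ^^ t) (0, 0, gtape 0 1 2 x) = (?eq q, h, ?es \<circ> f)" by blast
    show ?case
    proof (cases "q = qh")
      case True then show ?thesis using i e0 by auto
    next
      case False
      have n1: "?eq q \<noteq> 1" using False pq[OF i(2)] by (auto simp: lq_def)
      obtain q' b m where d1: "\<delta> q (f h) = (q', b, m)" by (metis prod_cases3)
      have fh: "f h \<in> S" using i(3) by auto
      have c: "q' \<in> Q" "b \<in> S" using closed[OF i(2) False fh] d1 by auto
      have "d (?eq q) (?es (f h)) = (?eq q', ?es b, m)"
        unfolding d_def using pq[OF i(2)] ps[OF fh] n1 d1 by auto
      then have "(fstep d 1 ^^ Suc t) (0, 0, gtape 0 1 2 x) = (?eq q', shift m h, (?es \<circ> f)(h := ?es b))"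
        using i(4) n1 by simp
      moreover have "(?es \<circ> f)(h := ?es b) = ?es \<circ> f(h := b)" by (auto simp: fun_eq_iff)
      moreover have "(fstep \<delta> qh ^^ Suc t) (q0, 0, gtape z s0 s1 x) = (q', shift m h, f(h := b))"
        using i(1) False d1 by simp
      moreover have "range (f(h := b)) \<subseteq> S" using i(3) c(2) by auto
      ultimately show ?thesis using c(1) by metis
    qed
  qed
  obtain c k where ck: "\<And>n. p n \<le> c * n ^ k + c" using p unfolding polybd_def by blast
  have "\<exists>t. t \<le> c * length x ^ k + c \<and> halts_with M x t [x \<in> V]" for x
  proof -
    obtain t h f where r: "t \<le> p (length x)"
      "(fstep \<delta> qh ^^ t) (q0, 0, gtape z s0 s1 x) = (qh, h, f)" 
      "f h = (if x \<in> V then s1 else s0)" "f (Suc h) \<noteq> s0" "f (Suc h) \<noteq> s1"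
      using run[of x] by blast
    from inv[where t=t and x=x] have i: "range f \<subseteq> S" "(fstep d 1 ^^ t) (0, 0, gtape 0 1 2 x) = (1, h, ?es \<circ> f)"
      using r(2) e0 by auto
    have "f (Suc h) \<in> S" using i(1) by auto
    then have "?es (f (Suc h)) \<noteq> 1" "?es (f (Suc h)) \<noteq> 2"
      using r(4,5) ps(2)[of "f (Suc h)"] n0 by auto
    then have "halts_with M x t [x \<in> V]"
      unfolding halts_with_iff using i e0 r(3) by (auto simp: M_def enc_bit_def)
    then show ?thesis using r(1) ck le_trans by blast
  qed
  then show ?thesis unfolding in_P_def poly_time_computable_def using wf by blast
qed

definition decider :: "(nat \<Rightarrow> nat \<Rightarrow> nat \<times> nat \<times> move) \<Rightarrow> nat \<Rightarrow> nat \<Rightarrow> nat \<Rightarrow> nat \<Rightarrow> lang \<Rightarrow> bool" where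
  "decider d n s c k V \<longleftrightarrow> 2 \<le> n \<and> 3 \<le> s \<and> (\<forall>q a. fst (d q a) < n \<and> fst (snd (d q a)) < s) \<and>
    (\<forall>x. \<exists>t \<le> c * length x ^ k + c. \<exists>h f. (fstep d 1 ^^ t) (0, 0, gtape 0 1 2 x) = (1, h, f)
      \<and> f h = enc_bit (x \<in> V) \<and> f (Suc h) \<noteq> 1 \<and> f (Suc h) \<noteq> 2)"

text \<open>The transition function is made total by halting outside the range of the machine.\<close>
lemma in_P_decider:
  assumes "in_P V"
  shows "\<exists>d n s c k. decider d n s c k V"
proof -
  obtain M c k where M: "wf_tm M" "\<And>x. \<exists>t \<le> c * length x ^ k + c. halts_with M x t [x \<in> V]"
    using assms unfolding in_P_def poly_time_computable_def by blast
  let ?n = "tm_states M" and ?s = "tm_symbols M"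
  define d where "d q a = (if q < ?n \<and> a < ?s then tm_delta M q a else (1, 0, MoveS))" for q a
  have wf: "2 \<le> ?n" "3 \<le> ?s" "fst (d q a) < ?n" "fst (snd (d q a)) < ?s" for q a
    using M(1) by (auto simp: wf_tm_def d_def)
  have same: "(fstep d 1 ^^ t) (0, 0, gtape 0 1 2 x) = (fstep (tm_delta M) 1 ^^ t) (0, 0, gtape 0 1 2 x) \<and>
      (\<exists>q h f. (fstep d 1 ^^ t) (0, 0, gtape 0 1 2 x) = (q, h, f) \<and> q < ?n \<and> (\<forall>i. f i < ?s))" for t x
  proof (induction t)
    case 0
    show ?case using wf(1,2) by (auto simp: gtape_def)
  next
    case (Suc t)
    then obtain q h f where c: "(fstep d 1 ^^ t) (0, 0, gtape 0 1 2 x) = (q, h, f)"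
      "(fstep (tm_delta M) 1 ^^ t) (0, 0, gtape 0 1 2 x) = (q, h, f)" "q < ?n" "\<forall>i. f i < ?s" by metis
    have e: "tm_delta M q (f h) = d q (f h)" using c by (simp add: d_def)
    obtain q' b m where dq: "d q (f h) = (q', b, m)" by (metis prod_cases3)
    then have "q' < ?n" "b < ?s" using wf(3,4)[of q "f h"] by auto
    then show ?case using c e dq by auto
  qed
  have "\<exists>t \<le> c * length x ^ k + c. \<exists>h f. (fstep d 1 ^^ t) (0, 0, gtape 0 1 2 x) = (1, h, f)
      \<and> f h = enc_bit (x \<in> V) \<and> f (Suc h) \<noteq> 1 \<and> f (Suc h) \<noteq> 2" for x
    using M(2)[of x] same[of _ x] unfolding halts_with_iff by fastforce
  then have "decider d ?n ?s c k V" unfolding decider_def using wf by blast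
  then show ?thesis by blast
qed

section \<open>Branching on a decidable property of a subsequence of the input\<close>

definition reach :: "('q \<Rightarrow> 's \<Rightarrow> 'q \<times> 's \<times> move) \<Rightarrow> 'q \<Rightarrow> nat \<Rightarrow>
    ('q, 's) fconf \<Rightarrow> ('q, 's) fconf \<Rightarrow> bool" where
  "reach \<delta> qh n c c' \<longleftrightarrow> (\<exists>t \<le> n. (fstep \<delta> qh ^^ t) c = c')"

lemma reach_refl: "reach \<delta> qh n c c"
  unfolding reach_def by (rule exI[of _ 0]) simp

lemma reach_step: "fstep \<delta> qh c = c' \<Longrightarrow> 1 \<le> n \<Longrightarrow> reach \<delta> qh n c c'"
  unfolding reach_def by (rule exI[of _ 1]) simp

lemma reach_trans:
  assumes "reach \<delta> qh m c c'" "reach \<delta> qh n c' c''" "m + n \<le> k"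
  shows "reach \<delta> qh k c c''"
proof -
  obtain s t where "s \<le> m" "(fstep \<delta> qh ^^ s) c = c'" "t \<le> n" "(fstep \<delta> qh ^^ t) c' = c''"
    using assms unfolding reach_def by blast
  then have "t + s \<le> k \<and> (fstep \<delta> qh ^^ (t + s)) c = c''" using assms(3) by (simp add: funpow_add)
  then show ?thesis unfolding reach_def by blast
qed

lemma reach_mono: "reach \<delta> qh m c c' \<Longrightarrow> m \<le> n \<Longrightarrow> reach \<delta> qh n c c'"
  using le_trans unfolding reach_def by blast

lemma reach_Suc: "fstep \<delta> qh c = c' \<Longrightarrow> reach \<delta> qh n c' c'' \<Longrightarrow> reach \<delta> qh (Suc n) c c''"
  by (rule reach_trans[OF reach_step[of _ _ _ _ 1]]) auto

text \<open>A Mealy machine that may stay silent on a letter: it extracts a sequence from the input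
  in one sweep with finite memory.\<close>

fun transd :: "('s \<Rightarrow> bool \<Rightarrow> 's) \<Rightarrow> ('s \<Rightarrow> bool \<Rightarrow> bool option) \<Rightarrow> 's \<Rightarrow> bool list \<Rightarrow> bool list" where
  "transd nxt out s [] = []"
| "transd nxt out s (b # xs) =
     (case out s b of None \<Rightarrow> transd nxt out (nxt s b) xs
      | Some c \<Rightarrow> c # transd nxt out (nxt s b) xs)"

lemma transd_append:
  "transd nxt out s (xs @ ys) = transd nxt out s xs @ transd nxt out (foldl nxt s xs) ys"
  by (induction xs arbitrary: s) (auto split: option.split)

lemma length_transd: "length (transd nxt out s xs) \<le> length xs"
  by (induction xs arbitrary: s) (auto split: option.split intro: le_SucI)

text \<open>The simulated tape is spread over the physical one: a cell \<open>Cell p None\<close> is skipped by the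
  simulation of the first machine, \<open>Cell p (Some w)\<close> holds its symbol \<open>w\<close>; in both cases \<open>p\<close> is the
  original input symbol, from which the input is restored for the second machine.\<close>
datatype sym = Raw nat | Cell nat "nat option" | LeftEnd nat

text \<open>The phases of a run: \<open>Mark\<close> runs the transducer and marks the cells,
  \<open>Ret\<close> goes back, \<open>Run\<close> and \<open>Lft\<close> simulate the first machine
  (\<open>Lft\<close> looks left for a cell that is not skipped), \<open>Fwd\<close> and
  \<open>Back\<close> carry the answer to the right end and restore the input on the way back,
  \<open>Snd\<close> runs the machine chosen by the answer.\<close>

datatype 's st = Start | Halt | Mark 's | Ret | Run nat | Lft nat | Fwd bool | Back bool | Snd bool nat

context
  fixes nxt :: "'s \<Rightarrow> bool \<Rightarrow> 's" and out :: "'s \<Rightarrow> bool \<Rightarrow> bool option" and s0 :: 's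
    and d1 :: "nat \<Rightarrow> nat \<Rightarrow> nat \<times> nat \<times> move" and d2 :: "bool \<Rightarrow> nat \<Rightarrow> nat \<Rightarrow> nat \<times> nat \<times> move"
begin

fun run_cell :: "nat \<Rightarrow> sym \<Rightarrow> nat \<Rightarrow> nat \<Rightarrow> 's st \<times> sym \<times> move" where
  "run_cell q a p w = (if q = 1 then (Fwd (w = 2), a, MoveS)
     else (case d1 q w of (q', b, m) \<Rightarrow> (if m = MoveL then Lft q' else Run q', Cell p (Some b), m)))"

fun br_delta :: "'s st \<Rightarrow> sym \<Rightarrow> 's st \<times> sym \<times> move" where
  "br_delta Start a = (case a of Raw p \<Rightarrow> (Mark (if p = 0 then s0 else nxt s0 (p = 2)), LeftEnd p, MoveR)
      | _ \<Rightarrow> (Halt, a, MoveS))"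
| "br_delta (Mark s) a = (case a of
       Raw p \<Rightarrow> if p = 0 then (Ret, a, MoveL)
          else (Mark (nxt s (p = 2)), Cell p (map_option enc_bit (out s (p = 2))), MoveR)
     | _ \<Rightarrow> (Halt, a, MoveS))"
| "br_delta Ret a = (case a of LeftEnd p \<Rightarrow> (Run 0, a, MoveR) | _ \<Rightarrow> (Ret, a, MoveL))"
| "br_delta (Run q) a = (case a of LeftEnd p \<Rightarrow> (Run q, a, MoveR)
     | Cell p None \<Rightarrow> (Run q, a, MoveR)
     | Cell p (Some w) \<Rightarrow> run_cell q a p w
     | Raw p \<Rightarrow> run_cell q a 0 0)"
| "br_delta (Lft q) a = (case a of LeftEnd p \<Rightarrow> (Run q, a, MoveR)
     | Cell p None \<Rightarrow> (Lft q, a, MoveL)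
     | _ \<Rightarrow> (Run q, a, MoveS))"
| "br_delta (Fwd b) a = (case a of Raw p \<Rightarrow> (Back b, a, MoveL) | _ \<Rightarrow> (Fwd b, a, MoveR))"
| "br_delta (Back b) a = (case a of Cell p _ \<Rightarrow> (Back b, Raw p, MoveL)
     | LeftEnd p \<Rightarrow> (Snd b 0, Raw p, MoveS)
     | Raw p \<Rightarrow> (Halt, a, MoveS))"
| "br_delta (Snd b q) a = (if q = 1 then (Halt, a, MoveS) else (case a of
       Raw p \<Rightarrow> (case d2 b q p of (q', c, m) \<Rightarrow> (Snd b q', Raw c, m))
     | _ \<Rightarrow> (Halt, a, MoveS)))"
| "br_delta Halt a = (Halt, a, MoveS)"

section \<open>The run of the branching machine on one input\<close>

context
  fixes x :: "bool list"
  assumes out0: "\<And>b. out s0 b = None"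
begin

abbreviation "orig \<equiv> gtape (0::nat) 1 2 x"

definition "sta j = foldl nxt s0 (take j x)"
definition "emit j = out (sta j) (x ! j)"
text \<open>Cell 0 holds the left end marker and cannot carry a simulated symbol;
  \<open>out0\<close> ensures that none is lost there. Cells beyond the input are never skipped and
  serve as fresh blanks.\<close>

definition "junk j \<longleftrightarrow> j = 0 \<or> (j < length x \<and> emit j = None)"
text \<open>The maximum accounts for the empty input, where cell 0 still becomes the marker.\<close>

definition "R0 = max 1 (length x)"

abbreviation "go \<equiv> reach br_delta Halt"

text \<open>The simulated position of a physical cell. A skipped cell shares the value of the next
  cell in use, so the head may rest on skipped cells between simulated steps.\<close>

primrec rank :: "nat \<Rightarrow> nat" where
  "rank 0 = 0"
| "rank (Suc j) = (if junk j then rank j else Suc (rank j))"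

lemma rank_mono: "i \<le> j \<Longrightarrow> rank i \<le> rank j"
  by (rule lift_Suc_mono_le[of rank]) auto

lemma rank_less: "i < j \<Longrightarrow> \<not> junk i \<Longrightarrow> rank i < rank j"
  using rank_mono[of "Suc i" j] by simp

lemma rank_inj: "\<not> junk i \<Longrightarrow> \<not> junk j \<Longrightarrow> rank i = rank j \<longleftrightarrow> i = j"
  by (metis linorder_neq_iff rank_less)

lemma junk_R0: "junk j \<Longrightarrow> j < R0"
  by (auto simp: junk_def R0_def)

lemma R0_pos: "1 \<le> R0" "length x \<le> R0" by (auto simp: R0_def)

lemma sta_Suc: "j < length x \<Longrightarrow> sta (Suc j) = nxt (sta j) (x ! j)"
  by (simp add: sta_def take_Suc_conv_app_nth)

lemma emit_0: "x \<noteq> [] \<Longrightarrow> emit 0 = None"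
  by (simp add: emit_def sta_def out0)

lemma rank_length: "j \<le> length x \<Longrightarrow> rank j = length (transd nxt out s0 (take j x))"
proof (induction j)
  case (Suc j)
  have "x \<noteq> []" using Suc.prems by auto
  then have "junk j \<longleftrightarrow> emit j = None"
    using Suc.prems emit_0 by (cases "j = 0") (auto simp: junk_def)
  then show ?case using Suc
    by (auto simp: take_Suc_conv_app_nth transd_append sta_def[symmetric] emit_def split: option.splits)
qed simp

lemma transd_nth:
  assumes "j < length x" "\<not> junk j"
  shows "rank j < length (transd nxt out s0 x)" "Some (transd nxt out s0 x ! rank j) = emit j"
proof -
  obtain c where c: "emit j = Some c" using assms by (auto simp: junk_def)
  have "x = take j x @ x ! j # drop (Suc j) x" using assms(1) by (rule id_take_nth_drop)
  then have "transd nxt out s0 x = transd nxt out s0 (take j x) @ transd nxt out (sta j) (x ! j # drop (Suc j) x)"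
    by (metis transd_append sta_def)
  also have "transd nxt out (sta j) (x ! j # drop (Suc j) x) = c # transd nxt out (sta (Suc j)) (drop (Suc j) x)"
    using c assms(1) by (simp add: emit_def sta_Suc)
  finally have "transd nxt out s0 x = transd nxt out s0 (take j x) @ c # transd nxt out (sta (Suc j)) (drop (Suc j) x)" .
  moreover have "rank j = length (transd nxt out s0 (take j x))" using assms(1) rank_length by simp
  ultimately show "rank j < length (transd nxt out s0 x)" "Some (transd nxt out s0 x ! rank j) = emit j"
    using c by auto
qed

lemma transd_beyond: "R0 \<le> j \<Longrightarrow> length (transd nxt out s0 x) \<le> rank j"
  using rank_length[of "length x"] rank_mono[of "length x" j] R0_pos by simp

text \<open>\<open>R\<close> is the end of the area converted to \<open>Cell\<close>, which grows
  with the simulation. The untouched \<open>Raw 0\<close> cells behind it are blanks of both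
  tapes.\<close>

definition "sim_inv R f f1 \<longleftrightarrow> R0 \<le> R \<and> f 0 = LeftEnd (orig 0)
  \<and> (\<forall>j. 0 < j \<and> j < R \<longrightarrow> f j = Cell (orig j) (if junk j then None else Some (f1 (rank j))))
  \<and> (\<forall>j \<ge> R. f j = Raw 0 \<and> f1 (rank j) = (0::nat))"

definition "marked k j = (if j < k then if j = 0 then LeftEnd (orig 0) else Cell (orig j) (map_option enc_bit (emit j))
   else Raw (orig j))"

lemma mark_steps: "k < R0 \<Longrightarrow> go k (Mark (sta 1), 1, marked 1) (Mark (sta (Suc k)), Suc k, marked (Suc k))"
proof (induction k)
  case (Suc k)
  then have k: "Suc k < length x" by (auto simp: R0_def)
  have "fstep br_delta Halt (Mark (sta (Suc k)), Suc k, marked (Suc k)) =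
      (Mark (sta (Suc (Suc k))), Suc (Suc k), marked (Suc (Suc k)))"
    using k by (auto simp: marked_def gtape_def sta_Suc emit_def fun_eq_iff)
  then show ?case using Suc by (intro reach_trans[OF Suc.IH reach_step[of _ _ _ _ 1]]) auto
qed (simp add: reach_refl)

lemma start_step: "fstep br_delta Halt (Start, 0, gtape (Raw 0) (Raw 1) (Raw 2) x) = (Mark (sta 1), 1, marked 1)"
proof -
  have "sta 1 = (if x = [] then s0 else nxt s0 (x ! 0))" unfolding sta_def by (cases x) auto
  moreover have "marked 1 = (gtape (Raw 0) (Raw 1) (Raw 2) x)(0 := LeftEnd (orig 0))"
    by (auto simp: marked_def gtape_def fun_eq_iff)
  ultimately show ?thesis by (auto simp: gtape_def)
qed

lemma turn_step: "fstep br_delta Halt (Mark (sta R0), R0, marked R0) = (Ret, R0 - 1, marked R0)"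
  using R0_pos by (auto simp: marked_def gtape_def fun_eq_iff)

lemma ret_steps: "j < R0 \<Longrightarrow> go (Suc j) (Ret, j, marked R0) (Run 0, 1, marked R0)"
proof (induction j)
  case 0
  then show ?case by (intro reach_step) (auto simp: marked_def fun_eq_iff)
next
  case (Suc j)
  then show ?case by (intro reach_Suc[OF _ Suc.IH]) (auto simp: marked_def fun_eq_iff)
qed

lemma prepare: "go (2 * R0 + 1) (Start, 0, gtape (Raw 0) (Raw 1) (Raw 2) x) (Run 0, 1, marked R0)"
proof -
  have 1: "go 1 (Start, 0, gtape (Raw 0) (Raw 1) (Raw 2) x) (Mark (sta 1), 1, marked 1)"
    using start_step by (rule reach_step) simp
  have 2: "go (R0 - 1) (Mark (sta 1), 1, marked 1) (Mark (sta R0), R0, marked R0)"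
    using mark_steps[of "R0 - 1"] R0_pos by simp
  have 3: "go 1 (Mark (sta R0), R0, marked R0) (Ret, R0 - 1, marked R0)"
    using turn_step by (rule reach_step) simp
  have 4: "go R0 (Ret, R0 - 1, marked R0) (Run 0, 1, marked R0)"
    using ret_steps[of "R0 - 1"] R0_pos by simp
  have 12: "go R0 (Start, 0, gtape (Raw 0) (Raw 1) (Raw 2) x) (Mark (sta R0), R0, marked R0)"
    using R0_pos by (intro reach_trans[OF 1 2]) simp
  have 34: "go (R0 + 1) (Mark (sta R0), R0, marked R0) (Run 0, 1, marked R0)"
    by (intro reach_trans[OF 3 4]) simp
  show ?thesis by (rule reach_trans[OF 12 34]) simp
qed

lemma inv_start: "sim_inv R0 (marked R0) (gtape 0 1 2 (transd nxt out s0 x))"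
  unfolding sim_inv_def
proof (intro conjI allI impI)
  show "marked R0 0 = LeftEnd (orig 0)" using R0_pos by (simp add: marked_def)
next
  fix j assume j: "0 < j \<and> j < R0"
  then have l: "j < length x" by (auto simp: R0_def)
  show "marked R0 j = Cell (orig j) (if junk j then None else Some (gtape 0 1 2 (transd nxt out s0 x) (rank j)))"
  proof (cases "junk j")
    case True
    then have "emit j = None" using j by (auto simp: junk_def)
    then show ?thesis using True j by (auto simp: marked_def)
  next
    case False
    have "emit j = Some (transd nxt out s0 x ! rank j)" using transd_nth(2)[OF l False] by simp
    then show ?thesis using j False transd_nth(1)[OF l False] by (auto simp: marked_def gtape_def enc_bit_def)
  qed
next
  fix j assume "R0 \<le> j"
  then show "marked R0 j = Raw 0" using R0_pos by (simp add: marked_def gtape_def)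
  show "gtape 0 1 2 (transd nxt out s0 x) (rank j) = 0"
    using transd_beyond[OF \<open>R0 \<le> j\<close>] by (simp add: gtape_def)
qed simp

lemma inv_junk: "sim_inv R f f1 \<Longrightarrow> junk h \<Longrightarrow> 0 < h \<Longrightarrow> f h = Cell (orig h) None"
  using junk_R0[of h] by (auto simp: sim_inv_def)

lemma inv_work: "sim_inv R f f1 \<Longrightarrow> \<not> junk h \<Longrightarrow>
   f h = Cell (orig h) (Some (f1 (rank h))) \<or> (R \<le> h \<and> f h = Raw 0 \<and> f1 (rank h) = 0 \<and> orig h = 0)"
  using R0_pos by (cases "h < R") (auto simp: sim_inv_def gtape_def junk_def)

text \<open>As the head is never beyond \<open>R\<close>, writing converts at most the one new cell
  \<open>R\<close> and leaves no gap.\<close>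

lemma inv_upd:
  assumes "sim_inv R f f1" "\<not> junk h" "h \<le> R"
  shows "sim_inv (max R (Suc h)) (f(h := Cell (orig h) (Some b))) (f1(rank h := b))"
proof -
  have "0 < h" using assms(2) by (auto simp: junk_def)
  have ge: "rank j \<noteq> rank h" if "max R (Suc h) \<le> j" for j
    using rank_less[of h j] that assms(2) by auto
  have "f j = Cell (orig j) (if junk j then None else Some ((f1(rank h := b)) (rank j)))"
    if "0 < j" "j < max R (Suc h)" "j \<noteq> h" for j
  proof -
    have "j < R" using that assms(3) by auto
    then have "f j = Cell (orig j) (if junk j then None else Some (f1 (rank j)))"
      using assms(1) that unfolding sim_inv_def by blast
    then show ?thesis using rank_inj[OF assms(2), of j] that by auto
  qed
  then have "(f(h := Cell (orig h) (Some b))) j = Cell (orig j) (if junk j then None else Some ((f1(rank h := b)) (rank j)))"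
    if "0 < j" "j < max R (Suc h)" for j
    using that assms(2) by (cases "j = h") auto
  moreover have "(f(h := Cell (orig h) (Some b))) j = Raw 0 \<and> (f1(rank h := b)) (rank j) = 0" if "max R (Suc h) \<le> j" for j
    using that ge[OF that] assms(1) by (auto simp: sim_inv_def)
  moreover have "R0 \<le> max R (Suc h)" "(f(h := Cell (orig h) (Some b))) 0 = LeftEnd (orig 0)"
    using assms(1) \<open>0 < h\<close> by (auto simp: sim_inv_def)
  ultimately show ?thesis unfolding sim_inv_def by blast
qed

text \<open>All skipped cells lie below \<open>R0\<close>, so the cost does not depend on how far
  the simulation has spread.\<close>

lemma skip_junk:
  "sim_inv R f f1 \<Longrightarrow> h \<le> R \<Longrightarrow> \<exists>h'. go (R0 - h) (Run q, h, f) (Run q, h', f) \<and> h \<le> h' \<and> h' \<le> R \<and> \<not> junk h' \<and> rank h' = rank h"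
proof (induction "R0 - h" arbitrary: h)
  case 0
  then have "\<not> junk h" using junk_R0[of h] by auto
  then show ?case using 0 by (intro exI[of _ h]) (simp add: reach_refl)
next
  case (Suc n)
  show ?case
  proof (cases "junk h")
    case False then show ?thesis using Suc.prems by (intro exI[of _ h]) (simp add: reach_refl)
  next
    case True
    have hR: "h < R0" using junk_R0[OF True] .
    have "Suc h \<le> R" using hR Suc.prems(1) by (auto simp: sim_inv_def)
    have "n = R0 - Suc h" using Suc.hyps(2) by simp
    from Suc.hyps(1)[OF this Suc.prems(1) \<open>Suc h \<le> R\<close>]
    obtain h' where h': "go (R0 - Suc h) (Run q, Suc h, f) (Run q, h', f)" "Suc h \<le> h'" "h' \<le> R" "\<not> junk h'" "rank h' = rank (Suc h)"
      by blast
    have "fstep br_delta Halt (Run q, h, f) = (Run q, Suc h, f)"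
      using inv_junk[OF Suc.prems(1) True] Suc.prems(1)
      by (cases "h = 0") (auto simp: fun_eq_iff sim_inv_def)
    from reach_Suc[OF this h'(1)] have "go (R0 - h) (Run q, h, f) (Run q, h', f)"
      using hR by (simp add: Suc_diff_Suc)
    then show ?thesis using h' True by (intro exI[of _ h']) auto
  qed
qed

text \<open>If no cell in use lies at \<open>h\<close> or to its left, the search bounces off the
  marker into cell 1, which has rank 0. This is the simulated head staying at its left end, and the
  truncated subtraction agrees.\<close>

lemma find_left:
  "sim_inv R f f1 \<Longrightarrow> h \<le> R \<Longrightarrow> \<exists>h'. go (Suc (min h R0)) (Lft q, h, f) (Run q, h', f) \<and> h' \<le> R \<and> rank h' = rank (Suc h) - 1"
proof (induction h)
  case 0
  have "f 0 = LeftEnd (orig 0)" "1 \<le> R" using 0 R0_pos by (auto simp: sim_inv_def)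
  then have "fstep br_delta Halt (Lft q, 0, f) = (Run q, 1, f)" by (auto simp: fun_eq_iff)
  then have "go (Suc (min 0 R0)) (Lft q, 0, f) (Run q, 1, f)" by (rule reach_step) simp
  then show ?case using \<open>1 \<le> R\<close> by (intro exI[of _ 1]) (auto simp: junk_def)
next
  case (Suc h)
  show ?case
  proof (cases "junk (Suc h)")
    case True
    have a: "fstep br_delta Halt (Lft q, Suc h, f) = (Lft q, h, f)"
      using inv_junk[OF Suc.prems(1) True] by (auto simp: fun_eq_iff)
    obtain h' where h': "go (Suc (min h R0)) (Lft q, h, f) (Run q, h', f)" "h' \<le> R" "rank h' = rank (Suc h) - 1"
      using Suc by auto
    have "go (Suc (min (Suc h) R0)) (Lft q, Suc h, f) (Run q, h', f)"
      using reach_Suc[OF a h'(1)] junk_R0[OF True] by (simp add: min_def)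
    then show ?thesis using h' True by (intro exI[of _ h']) auto
  next
    case False
    have "fstep br_delta Halt (Lft q, Suc h, f) = (Run q, Suc h, f)"
      using inv_work[OF Suc.prems(1) False] by (auto simp: fun_eq_iff)
    then have "go (Suc (min (Suc h) R0)) (Lft q, Suc h, f) (Run q, Suc h, f)" by (rule reach_step) simp
    then show ?thesis using False Suc.prems by (intro exI[of _ "Suc h"]) auto
  qed
qed

fun simrel :: "nat \<Rightarrow> (nat, nat) fconf \<Rightarrow> ('s st, sym) fconf \<Rightarrow> bool" where
  "simrel i (q, h1, f1) c \<longleftrightarrow> (\<exists>h f R. c = (Run q, h, f) \<and> sim_inv R f f1 \<and> h \<le> R \<and> rank h = h1 \<and> R \<le> R0 + i)"

text \<open>The cost pays for reaching the next cell in use, the step itself and, for a left move,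
  the search for the previous cell in use. At most one new cell is used, so the bound on
  \<open>R\<close> in \<open>simrel\<close> grows by one.\<close>

lemma sim_step:
  assumes "simrel i c1 c"
  shows "\<exists>c'. go (2 * R0 + 2) c c' \<and> simrel (Suc i) (fstep d1 1 c1) c'"
proof -
  obtain q h1 f1 where c1: "c1 = (q, h1, f1)" by (cases c1) auto
  obtain h f R where c: "c = (Run q, h, f)" "sim_inv R f f1" "h \<le> R" "rank h = h1" "R \<le> R0 + i"
    using assms c1 by auto
  show ?thesis
  proof (cases "q = 1")
    case True
    have "simrel (Suc i) (fstep d1 1 c1) c" using True c c1 by fastforce
    then show ?thesis by (intro exI[of _ c]) (simp add: reach_refl)
  next
    case False
    obtain g where g: "go (R0 - h) c (Run q, g, f)" "h \<le> g" "g \<le> R" "\<not> junk g" "rank g = h1"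
      using skip_junk[OF c(2,3)] c by auto
    obtain q' b m where d: "d1 q (f1 h1) = (q', b, m)" by (metis prod_cases3)
    let ?f = "f(g := Cell (orig g) (Some b))" and ?f1 = "f1(h1 := b)"
    let ?R = "max R (Suc g)"
    have next1: "fstep d1 1 c1 = (q', shift m h1, ?f1)" using False d c1 by simp
    have i': "sim_inv ?R ?f ?f1" using inv_upd[OF c(2) g(4,3)] g(5) by simp
    have bd: "?R \<le> R0 + Suc i" using c(5) g(3) by auto
    have s: "fstep br_delta Halt (Run q, g, f) = (if m = MoveL then Lft q' else Run q', shift m g, ?f)"
      using inv_work[OF c(2) g(4)] g(5) d False by auto
    have g1: "go (R0 - h + 1) c (if m = MoveL then Lft q' else Run q', shift m g, ?f)"
      by (rule reach_trans[OF g(1) reach_step[OF s]]) auto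
    show ?thesis
    proof (cases "m = MoveL")
      case True
      have "g - 1 \<le> ?R" by auto
      from find_left[OF i' this] obtain h' where
        h': "go (Suc (min (g - 1) R0)) (Lft q', g - 1, ?f) (Run q', h', ?f)" "h' \<le> ?R" "rank h' = rank (Suc (g - 1)) - 1"
        by blast
      have "0 < g" using g(4) by (auto simp: junk_def)
      then have "rank h' = h1 - 1" using h'(3) g(5) by simp
      then have "simrel (Suc i) (fstep d1 1 c1) (Run q', h', ?f)"
        using next1 True i' h'(2) bd by fastforce
      moreover have "go (2 * R0 + 2) c (Run q', h', ?f)"
        using g1 True by (intro reach_trans[OF _ h'(1), of "R0 - h + 1"]) auto
      ultimately show ?thesis by blast
    next
      case False
      have "rank (shift m g) = shift m h1" "shift m g \<le> ?R" using False g by (cases m; simp)+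
      then have "simrel (Suc i) (fstep d1 1 c1) (Run q', shift m g, ?f)"
        using next1 False i' bd by fastforce
      moreover have "go (2 * R0 + 2) c (Run q', shift m g, ?f)"
        using g1 False by (auto intro: reach_mono)
      ultimately show ?thesis by blast
    qed
  qed
qed

lemma sim_steps:
  assumes "simrel 0 c1 c"
  shows "\<exists>c'. go (t * (2 * R0 + 2)) c c' \<and> simrel t ((fstep d1 1 ^^ t) c1) c'"
proof (induction t)
  case 0
  show ?case using assms by (intro exI[of _ c]) (simp add: reach_refl)
next
  case (Suc t)
  then obtain c' where c': "go (t * (2 * R0 + 2)) c c'" "simrel t ((fstep d1 1 ^^ t) c1) c'" by blast
  from sim_step[OF c'(2)] obtain c'' where "go (2 * R0 + 2) c' c''" "simrel (Suc t) ((fstep d1 1 ^^ Suc t) c1) c''"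
    by auto
  then show ?case by (intro exI[of _ c''] conjI reach_trans[OF c'(1)]) auto
qed

lemma fwd_steps:
  "sim_inv R f f1 \<Longrightarrow> h \<le> R \<Longrightarrow> go (Suc (R - h)) (Fwd b, h, f) (Back b, R - 1, f)"
proof (induction "R - h" arbitrary: h)
  case 0
  then have "f h = Raw 0" "h = R" by (auto simp: sim_inv_def)
  then show ?case by (intro reach_step) (auto simp: fun_eq_iff)
next
  case (Suc n)
  have "\<exists>p w. f h = Cell p w \<or> f h = LeftEnd p"
    using Suc by (cases "h = 0") (auto simp: sim_inv_def)
  then have "fstep br_delta Halt (Fwd b, h, f) = (Fwd b, Suc h, f)" by (auto simp: fun_eq_iff)
  moreover have "go (R - h) (Fwd b, Suc h, f) (Back b, R - 1, f)"
    using Suc.hyps(1)[of "Suc h"] Suc.hyps(2) Suc.prems by (metis Suc_diff_Suc Suc_leI diff_Suc_Suc diff_is_0_eq' diff_diff_left nat.inject not_less_eq_eq plus_1_eq_Suc zero_less_Suc zero_less_diff)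
  ultimately show ?case by (rule reach_Suc)
qed

lemma back_steps:
  "sim_inv R f f1 \<Longrightarrow> j < R \<Longrightarrow> go (Suc j) (Back b, j, \<lambda>k. if k \<le> j then f k else Raw (orig k)) (Snd b 0, 0, \<lambda>k. Raw (orig k))"
proof (induction j)
  case 0
  then have "f 0 = LeftEnd (orig 0)" by (auto simp: sim_inv_def)
  then show ?case by (intro reach_step) (auto simp: fun_eq_iff)
next
  case (Suc j)
  obtain w where "f (Suc j) = Cell (orig (Suc j)) w" using Suc.prems by (auto simp: sim_inv_def)
  then have "fstep br_delta Halt (Back b, Suc j, \<lambda>k. if k \<le> Suc j then f k else Raw (orig k)) =
     (Back b, j, \<lambda>k. if k \<le> j then f k else Raw (orig k))"
    by (auto simp: fun_eq_iff le_Suc_eq)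
  moreover have "go (Suc j) (Back b, j, \<lambda>k. if k \<le> j then f k else Raw (orig k)) (Snd b 0, 0, \<lambda>k. Raw (orig k))"
    using Suc.IH Suc.prems by simp
  ultimately show ?case by (rule reach_Suc)
qed

text \<open>Every \<open>Cell\<close> has kept its input symbol, and the cells from \<open>R\<close>
  on are blank in the input as well.\<close>

lemma restore:
  assumes "sim_inv R f f1" "h \<le> R"
  shows "go (2 * R + 1) (Fwd b, h, f) (Snd b 0, 0, gtape (Raw 0) (Raw 1) (Raw 2) x)"
proof -
  have R: "1 \<le> R" "length x \<le> R" using assms(1) R0_pos by (auto simp: sim_inv_def)
  have f: "f = (\<lambda>k. if k \<le> R - 1 then f k else Raw (orig k))"
    using assms(1) R by (auto simp: sim_inv_def fun_eq_iff gtape_def)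
  have "(\<lambda>k. Raw (orig k)) = gtape (Raw 0) (Raw 1) (Raw 2) x" by (auto simp: gtape_def fun_eq_iff)
  then have "go R (Back b, R - 1, f) (Snd b 0, 0, gtape (Raw 0) (Raw 1) (Raw 2) x)"
    using back_steps[OF assms(1), of "R - 1"] R f by simp
  then show ?thesis by (rule reach_trans[OF fwd_steps[OF assms]]) simp
qed

lemma second_steps:
  "\<exists>q h f. (fstep (d2 b) 1 ^^ t) (0, 0, gtape 0 1 2 x) = (q, h, f) \<and>
     go t (Snd b 0, 0, gtape (Raw 0) (Raw 1) (Raw 2) x) (Snd b q, h, Raw \<circ> f)"
proof (induction t)
  case 0
  have "gtape (Raw 0) (Raw 1) (Raw 2) x = Raw \<circ> gtape 0 1 2 x" by (auto simp: gtape_def fun_eq_iff)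
  then show ?case by (auto simp: reach_refl)
next
  case (Suc t)
  then obtain q h f where c: "(fstep (d2 b) 1 ^^ t) (0, 0, gtape 0 1 2 x) = (q, h, f)"
     "go t (Snd b 0, 0, gtape (Raw 0) (Raw 1) (Raw 2) x) (Snd b q, h, Raw \<circ> f)" by blast
  show ?case
  proof (cases "q = 1")
    case True
    then show ?thesis using c(1) reach_mono[OF c(2), of "Suc t"] by (simp add: o_def)
  next
    case False
    obtain q' a m where d: "d2 b q (f h) = (q', a, m)" by (metis prod_cases3)
    have "fstep br_delta Halt (Snd b q, h, Raw \<circ> f) = (Snd b q', shift m h, (Raw \<circ> f)(h := Raw a))"
      using d False by auto
    also have "(Raw \<circ> f)(h := Raw a) = Raw \<circ> f(h := a)" by (auto simp: fun_eq_iff)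
    finally have s: "fstep br_delta Halt (Snd b q, h, Raw \<circ> f) = (Snd b q', shift m h, Raw \<circ> f(h := a))" .
    have "go (Suc t) (Snd b 0, 0, gtape (Raw 0) (Raw 1) (Raw 2) x) (Snd b q', shift m h, Raw \<circ> f(h := a))"
      by (rule reach_trans[OF c(2) reach_step[OF s, of 1]]) auto
    moreover have "(fstep (d2 b) 1 ^^ Suc t) (0, 0, gtape 0 1 2 x) = (q', shift m h, f(h := a))"
      using c(1) d False by simp
    ultimately show ?thesis by blast
  qed
qed

lemma branch_run:
  assumes m1: "(fstep d1 1 ^^ t1) (0, 0, gtape 0 1 2 (transd nxt out s0 x)) = (1, h1, f1)" "f1 h1 = enc_bit b"
    and m2: "(fstep (d2 b) 1 ^^ t2) (0, 0, gtape 0 1 2 x) = (1, h2, f2)"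
  shows "go (t1 * (2 * R0 + 2) + 5 * R0 + 2 * t1 + t2 + 4)
      (Start, 0, gtape (Raw 0) (Raw 1) (Raw 2) x) (Halt, h2, Raw \<circ> f2)"
proof -
  have "rank 1 = 0" "1 \<le> R0" using R0_pos by (auto simp: junk_def)
  then have "simrel 0 (0, 0, gtape 0 1 2 (transd nxt out s0 x)) (Run 0, 1, marked R0)"
    using inv_start by fastforce
  from sim_steps[OF this, of t1] m1 obtain h f R where
    s: "go (t1 * (2 * R0 + 2)) (Run 0, 1, marked R0) (Run 1, h, f)" "sim_inv R f f1" "h \<le> R" "rank h = h1" "R \<le> R0 + t1"
    by auto
  from skip_junk[OF s(2,3), where q = 1] s(4) obtain g where
    g: "go (R0 - h) (Run 1, h, f) (Run 1, g, f)" "g \<le> R" "\<not> junk g" "rank g = h1" by auto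
  have "fstep br_delta Halt (Run 1, g, f) = (Fwd b, g, f)"
    using inv_work[OF s(2) g(3)] g(4) m1(2) by (cases b) (auto simp: fun_eq_iff enc_bit_def)
  from reach_trans[OF g(1) reach_step[OF this, of 1]]
  have 3: "go (R0 + 1) (Run 1, h, f) (Fwd b, g, f)" by simp
  have 4: "go (2 * R + 1) (Fwd b, g, f) (Snd b 0, 0, gtape (Raw 0) (Raw 1) (Raw 2) x)"
    by (rule restore[OF s(2) g(2)])
  have 5: "go t2 (Snd b 0, 0, gtape (Raw 0) (Raw 1) (Raw 2) x) (Snd b 1, h2, Raw \<circ> f2)"
    using second_steps[where b = b and t = t2] m2 by auto
  have 6: "go 1 (Snd b 1, h2, Raw \<circ> f2) (Halt, h2, Raw \<circ> f2)"
    by (rule reach_step) (auto simp: fun_eq_iff)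
  have 12: "go (2 * R0 + 1 + t1 * (2 * R0 + 2)) (Start, 0, gtape (Raw 0) (Raw 1) (Raw 2) x) (Run 1, h, f)"
    by (rule reach_trans[OF prepare s(1)]) simp
  have 34: "go (R0 + 1 + (2 * R + 1)) (Run 1, h, f) (Snd b 0, 0, gtape (Raw 0) (Raw 1) (Raw 2) x)"
    by (rule reach_trans[OF 3 4]) simp
  have 56: "go (t2 + 1) (Snd b 0, 0, gtape (Raw 0) (Raw 1) (Raw 2) x) (Halt, h2, Raw \<circ> f2)"
    by (rule reach_trans[OF 5 6]) simp
  show ?thesis
    by (rule reach_trans[OF reach_trans[OF 12 34 order_refl] 56]) (use s(5) in simp)
qed

end

end

text \<open>The input is intact after the first test, so \<open>V2\<close> and \<open>V3\<close> may
  be given by further tests of this kind; nesting yields all Boolean combinations.\<close>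

lemma in_P_branch:
  fixes nxt :: "'s \<Rightarrow> bool \<Rightarrow> 's"
  assumes V: "in_P V1" "in_P V2" "in_P V3"
    and K: "finite K" "s0 \<in> K" "\<And>s b. s \<in> K \<Longrightarrow> nxt s b \<in> K"
    and out0: "\<And>b. out s0 b = None"
  shows "in_P {x. if transd nxt out s0 x \<in> V1 then x \<in> V2 else x \<in> V3}" (is "in_P ?V")
proof -
  obtain d1 n1 u1 c1 k1 where "decider d1 n1 u1 c1 k1 V1" using in_P_decider[OF V(1)] by blast
  then have M1: "2 \<le> n1" "3 \<le> u1" "\<And>q a. fst (d1 q a) < n1" "\<And>q a. fst (snd (d1 q a)) < u1"
    and r1: "\<And>x. \<exists>t \<le> c1 * length x ^ k1 + c1. \<exists>h f. (fstep d1 1 ^^ t) (0, 0, gtape 0 1 2 x) = (1, h, f)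
      \<and> f h = enc_bit (x \<in> V1) \<and> f (Suc h) \<noteq> 1 \<and> f (Suc h) \<noteq> 2"
    by (simp_all add: decider_def)
  obtain e2 n2 u2 c2 k2 where "decider e2 n2 u2 c2 k2 V2" using in_P_decider[OF V(2)] by blast
  then have M2: "2 \<le> n2" "3 \<le> u2" "\<And>q a. fst (e2 q a) < n2" "\<And>q a. fst (snd (e2 q a)) < u2"
    and r2: "\<And>x. \<exists>t \<le> c2 * length x ^ k2 + c2. \<exists>h f. (fstep e2 1 ^^ t) (0, 0, gtape 0 1 2 x) = (1, h, f)
      \<and> f h = enc_bit (x \<in> V2) \<and> f (Suc h) \<noteq> 1 \<and> f (Suc h) \<noteq> 2"
    by (simp_all add: decider_def)
  obtain e3 n3 u3 c3 k3 where "decider e3 n3 u3 c3 k3 V3" using in_P_decider[OF V(3)] by blast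
  then have M3: "2 \<le> n3" "3 \<le> u3" "\<And>q a. fst (e3 q a) < n3" "\<And>q a. fst (snd (e3 q a)) < u3"
    and r3: "\<And>x. \<exists>t \<le> c3 * length x ^ k3 + c3. \<exists>h f. (fstep e3 1 ^^ t) (0, 0, gtape 0 1 2 x) = (1, h, f)
      \<and> f h = enc_bit (x \<in> V3) \<and> f (Suc h) \<noteq> 1 \<and> f (Suc h) \<noteq> 2"
    by (simp_all add: decider_def)
  define d2 where "d2 b = (if b then e2 else e3)" for b
  define n where "n = max n2 n3"
  define u where "u = max u2 u3"
  have d2: "fst (d2 b q a) < n" "fst (snd (d2 b q a)) < u" for b q a
    using M2(3,4)[of q a] M3(3,4)[of q a] by (auto simp: d2_def n_def u_def)
  have nu: "0 < n" "0 < n1" "3 \<le> u" using M1 M2 by (auto simp: n_def u_def)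
  let ?\<delta> = "br_delta nxt out s0 d1 d2"
  define Q where "Q = {Start, Halt, Ret} \<union> Mark ` K \<union> Run ` {..<n1} \<union> Lft ` {..<n1}
     \<union> range Fwd \<union> range Back \<union> (\<lambda>(b, q). Snd b q) ` (UNIV \<times> {..<n})"
  \<comment> \<open>The 3 makes room for the symbols \<open>enc_bit b\<close> that the marking phase
    writes.\<close>
  define W where "W = insert None (Some ` {..<max 3 u1})"
  have W: "finite W" "None \<in> W" "Some w \<in> W \<longleftrightarrow> w < max 3 u1" for w by (auto simp: W_def)
  define S where "S = Raw ` {..<u} \<union> (\<lambda>(p, w). Cell p w) ` ({..<u} \<times> W) \<union> LeftEnd ` {..<u}"
  have Q: "Start \<in> Q" "Halt \<in> Q" "Ret \<in> Q" "Mark s \<in> Q \<longleftrightarrow> s \<in> K" "Run q \<in> Q \<longleftrightarrow> q < n1" "Lft q \<in> Q \<longleftrightarrow> q < n1"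
    "Fwd b \<in> Q" "Back b \<in> Q" "Snd b q \<in> Q \<longleftrightarrow> q < n" for s q b
    by (auto simp: Q_def image_iff)
  have S: "Raw a \<in> S \<longleftrightarrow> a < u" "Cell a w \<in> S \<longleftrightarrow> a < u \<and> w \<in> W" "LeftEnd a \<in> S \<longleftrightarrow> a < u" for a w
    by (auto simp: S_def image_iff)
  have out_W: "map_option enc_bit z \<in> W" for z
    by (cases z) (simp_all add: W enc_bit_def less_max_iff_disj)
  have run: "fst (run_cell d1 q a p w) \<in> Q" "fst (snd (run_cell d1 q a p w)) \<in> S"
    if "q < n1" "a \<in> S" "p < u" for q a p w
  proof -
    obtain q' b m where d: "d1 q w = (q', b, m)" by (metis prod_cases3)
    then have "q' < n1" "b < max 3 u1" using M1(3,4)[of q w] by auto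
    then show "fst (run_cell d1 q a p w) \<in> Q" "fst (snd (run_cell d1 q a p w)) \<in> S"
      using that by (simp_all add: d Q S W)
  qed
  have closed: "fst (?\<delta> q a) \<in> Q \<and> fst (snd (?\<delta> q a)) \<in> S" if qa: "q \<in> Q" "q \<noteq> Halt" "a \<in> S" for q a
  proof (cases q)
    case (Mark s)
    then show ?thesis using qa by (cases a) (simp_all add: K(3) Q S out_W)
  next
    case (Run q1)
    show ?thesis
    proof (cases a)
      case (Raw p)
      then show ?thesis using Run qa nu run[of q1 a 0 0] by (simp add: Q S del: run_cell.simps)
    next
      case (Cell p w)
      then show ?thesis using Run qa run[of q1 a p] by (cases w) (simp_all add: Q S del: run_cell.simps)
    next
      case (LeftEnd p)
      then show ?thesis using Run qa by (simp add: Q S)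
    qed
  next
    case (Snd b q1)
    show ?thesis
    proof (cases a)
      case (Raw p)
      obtain q' c m where d: "d2 b q1 p = (q', c, m)" by (metis prod_cases3)
      then have "q' < n" "c < u" using d2[of b q1 p] by auto
      then show ?thesis using Snd Raw qa by (simp add: d Q S)
    qed (use Snd qa in \<open>simp_all add: Q S\<close>)
  next
    case Start
    then show ?thesis using qa by (cases a) (simp_all add: K(2,3) Q S)
  next
    case Ret
    then show ?thesis using qa nu by (cases a) (simp_all add: Q S)
  next
    case (Lft q1)
    then show ?thesis using qa by (cases a) (auto simp: Q S split: option.split)
  next
    case (Fwd b)
    then show ?thesis using qa by (cases a) (simp_all add: Q S)
  next
    case (Back b)
    then show ?thesis using qa nu by (cases a) (simp_all add: Q S)
  qed (use qa in simp)
  have fin: "finite Q" "finite S" using K(1) W(1) by (auto simp: Q_def S_def)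
  \<comment> \<open>The bound of \<open>branch_run\<close> with \<open>R0 \<le> n + 1\<close>; the
    times of both possible second machines are added.\<close>
  let ?p = "\<lambda>n. (c1 * n ^ k1 + c1) * (2 * (n + 1) + 2) + 5 * (n + 1) + 2 * (c1 * n ^ k1 + c1)
      + ((c2 * n ^ k2 + c2) + (c3 * n ^ k3 + c3)) + 4"
  show ?thesis
  proof (rule in_P_generic[where \<delta> = ?\<delta> and ?q0.0 = Start and qh = Halt and Q = Q and S = S
        and z = "Raw 0" and ?s0.0 = "Raw 1" and ?s1.0 = "Raw 2" and p = ?p])
    show "polybd ?p" by (intro polybd_add polybd_mult polybd_power polybd_const polybd_id)
    fix x
    let ?y = "transd nxt out s0 x"
    obtain t1 h1 f1 where t1: "t1 \<le> c1 * length ?y ^ k1 + c1"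
      "(fstep d1 1 ^^ t1) (0, 0, gtape 0 1 2 ?y) = (1, h1, f1)" "f1 h1 = enc_bit (?y \<in> V1)"
      using r1[of ?y] by blast
    have "length ?y ^ k1 \<le> length x ^ k1" using length_transd by (rule power_mono) simp
    then have t1': "t1 \<le> c1 * length x ^ k1 + c1"
      using t1(1) by (meson add_le_mono1 le_trans mult_le_mono2)
    obtain t2 h2 f2 where t2: "t2 \<le> (c2 * length x ^ k2 + c2) + (c3 * length x ^ k3 + c3)"
      "(fstep (d2 (?y \<in> V1)) 1 ^^ t2) (0, 0, gtape 0 1 2 x) = (1, h2, f2)"
      "f2 h2 = enc_bit (x \<in> ?V)" "f2 (Suc h2) \<noteq> 1" "f2 (Suc h2) \<noteq> 2"
    proof (cases "?y \<in> V1")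
      case True
      with r2[of x] that show ?thesis by (auto simp: d2_def intro: trans_le_add1)
    next
      case False
      with r3[of x] that show ?thesis by (auto simp: d2_def intro: trans_le_add2)
    qed
    have "R0 x \<le> length x + 1" by (simp add: R0_def)
    then have "t1 * (2 * R0 x + 2) \<le> (c1 * length x ^ k1 + c1) * (2 * (length x + 1) + 2)"
      using t1' by (intro mult_le_mono) auto
    then have "t1 * (2 * R0 x + 2) + 5 * R0 x + 2 * t1 + t2 + 4 \<le> ?p (length x)"
      using t1' t2(1) \<open>R0 x \<le> length x + 1\<close> by (intro add_mono mult_le_mono) simp_all
    from reach_mono[OF branch_run[where ?d2.0 = d2, OF out0 t1(2,3) t2(2)] this]
    obtain t where "t \<le> ?p (length x)"
      "(fstep ?\<delta> Halt ^^ t) (Start, 0, gtape (Raw 0) (Raw 1) (Raw 2) x) = (Halt, h2, Raw \<circ> f2)"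
      unfolding reach_def by blast
    then show "\<exists>t \<le> ?p (length x). \<exists>h f. (fstep ?\<delta> Halt ^^ t) (Start, 0, gtape (Raw 0) (Raw 1) (Raw 2) x) = (Halt, h, f)
       \<and> f h = (if x \<in> ?V then Raw 2 else Raw 1) \<and> f (Suc h) \<noteq> Raw 1 \<and> f (Suc h) \<noteq> Raw 2"
      using t2(3-5) by (intro exI[of _ t] conjI exI[of _ h2] exI[of _ "Raw \<circ> f2"]) (auto simp: enc_bit_def)
  qed (use fin closed nu in \<open>simp_all add: Q S\<close>)
qed

section \<open>Comparing the numbers of bits\<close>

lemma in_P_const: "in_P {x. v}"
proof -
  \<comment> \<open>State 2 blanks the cell after the answer, because an input bit there would be
    read as a second output bit.\<close>
  define \<delta> :: "nat \<Rightarrow> nat \<Rightarrow> nat \<times> nat \<times> move" where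
    "\<delta> q a = (if q = 0 then (2, enc_bit v, MoveR) else (1, 0, MoveL))" for q a
  show ?thesis
  proof (rule in_P_generic[where \<delta> = \<delta> and ?q0.0 = 0 and qh = 1 and Q = "{0, 1, 2}" and S = "{0, 1, 2}"
        and z = 0 and ?s0.0 = 1 and ?s1.0 = 2 and p = "\<lambda>_. 2"])
    show "\<exists>t \<le> 2. \<exists>h f. (fstep \<delta> 1 ^^ t) (0, 0, gtape 0 1 2 x) = (1, h, f) \<and>
        f h = (if x \<in> {x. v} then 2 else 1) \<and> f (Suc h) \<noteq> 1 \<and> f (Suc h) \<noteq> 2" for x
      by (rule exI[of _ 2]) (auto simp: numeral_2_eq_2 \<delta>_def enc_bit_def)
  qed (auto simp: \<delta>_def enc_bit_def)
qed

datatype maj_state = MStart | MHalt | Sweep bool bool | MBack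

text \<open>Symbol 3 marks the left end and 4 a deleted bit. One sweep to the right deletes one \<open>False\<close> and
  one \<open>True\<close> (the flags record which of them was found).\<close>
fun maj_delta :: "maj_state \<Rightarrow> nat \<Rightarrow> maj_state \<times> nat \<times> move" where
  "maj_delta MStart a = (if a = 0 then (MHalt, 2, MoveS) else (Sweep (a = 1) (a \<noteq> 1), 3, MoveR))"
| "maj_delta (Sweep u v) a =
     (if a = 0 then (if \<not> u then (MHalt, 2, MoveS) else if \<not> v then (MHalt, 1, MoveS) else (MBack, 0, MoveL))
      else if a = 1 \<and> \<not> u then (Sweep True v, 4, MoveR)
      else if a = 2 \<and> \<not> v then (Sweep u True, 4, MoveR)
      else (Sweep u v, a, MoveR))"
| "maj_delta MBack a = (if a = 3 then (Sweep False False, 3, MoveR) else (MBack, a, MoveL))"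
| "maj_delta MHalt a = (MHalt, a, MoveS)"

abbreviation "mgo \<equiv> reach maj_delta MHalt"

definition maj_tape :: "nat \<Rightarrow> (nat \<Rightarrow> nat) \<Rightarrow> bool" where
  "maj_tape N f \<longleftrightarrow> 1 \<le> N \<and> f 0 = 3 \<and> (\<forall>j. 0 < j \<and> j < N \<longrightarrow> f j \<in> {1, 2, 4}) \<and> (\<forall>j \<ge> N. f j = 0)"

text \<open>Cell 0 is left out: the marker has overwritten the first bit, which survives only in the
  flags of \<open>Sweep\<close>.\<close>

definition occ :: "nat \<Rightarrow> nat \<Rightarrow> (nat \<Rightarrow> nat) \<Rightarrow> nat" where
  "occ N v f = card {j. 0 < j \<and> j < N \<and> f j = v}"

lemma finite_occ: "finite {j::nat. 0 < j \<and> j < N \<and> P j}"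
  by (rule finite_subset[of _ "{..<N}"]) auto

lemma occ_upd:
  assumes "0 < h" "h < N" "f h \<noteq> 4" "v \<noteq> 4"
  shows "occ N v (f(h := 4)) + of_bool (f h = v) = occ N v f"
proof (cases "f h = v")
  case True
  have "{j. 0 < j \<and> j < N \<and> f j = v} = insert h {j. 0 < j \<and> j < N \<and> (f(h := 4)) j = v}"
    using assms True by auto
  moreover have "h \<notin> {j. 0 < j \<and> j < N \<and> (f(h := 4)) j = v}" using assms by auto
  ultimately show ?thesis unfolding occ_def using True by (simp add: finite_occ)
next
  case False
  then have "{j. 0 < j \<and> j < N \<and> f j = v} = {j. 0 < j \<and> j < N \<and> (f(h := 4)) j = v}"
    using assms by auto
  then show ?thesis using False by (simp add: occ_def)
qed

lemma occ_0: "(\<And>j. 0 < j \<Longrightarrow> j < N \<Longrightarrow> f j \<noteq> v) \<Longrightarrow> occ N v f = 0"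
  by (auto simp: occ_def card_eq_0_iff)

text \<open>Setting a flag deletes one bit, so flag plus remaining count is invariant. A flag still
  unset at the right end means that no bit of its kind was left.\<close>

lemma sweep:
  assumes "maj_tape N f" "1 \<le> h" "h \<le> N"
    "\<not> u \<Longrightarrow> \<forall>j. 0 < j \<and> j < h \<longrightarrow> f j \<noteq> 1" "\<not> v \<Longrightarrow> \<forall>j. 0 < j \<and> j < h \<longrightarrow> f j \<noteq> 2"
  shows "\<exists>u' v' f'. mgo (N - h) (Sweep u v, h, f) (Sweep u' v', N, f') \<and> maj_tape N f' \<and>
     of_bool u' + occ N 1 f' = of_bool u + occ N 1 f \<and> of_bool v' + occ N 2 f' = of_bool v + occ N 2 f \<and>
     (\<not> u' \<longrightarrow> occ N 1 f' = 0) \<and> (\<not> v' \<longrightarrow> occ N 2 f' = 0)"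
  using assms
proof (induction "N - h" arbitrary: h u v f)
  case 0
  then have "h = N" by simp
  then have "\<not> u \<longrightarrow> occ N 1 f = 0" "\<not> v \<longrightarrow> occ N 2 f = 0" using 0 by (auto intro!: occ_0)
  then show ?case using 0 \<open>h = N\<close> by (intro exI[of _ u] exI[of _ v] exI[of _ f]) (simp add: reach_refl)
next
  case (Suc n)
  have n: "n = N - Suc h" and h: "h < N" "1 \<le> Suc h" "Suc h \<le> N" "0 < h" using Suc.hyps(2) Suc.prems by auto
  define u1 where "u1 = (u \<or> f h = 1)"
  define v1 where "v1 = (v \<or> f h = 2)"
  define f1 where "f1 = (if (f h = 1 \<and> \<not> u) \<or> (f h = 2 \<and> \<not> v) then f(h := 4) else f)"
  have fh: "f h \<in> {1, 2, 4}" using Suc.prems h by (auto simp: maj_tape_def)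
  have s: "fstep maj_delta MHalt (Sweep u v, h, f) = (Sweep u1 v1, Suc h, f1)"
    using fh by (auto simp: u1_def v1_def f1_def)
  have t: "maj_tape N f1" using Suc.prems(1) h by (auto simp: maj_tape_def f1_def)
  have c: "\<not> u1 \<Longrightarrow> \<forall>j. 0 < j \<and> j < Suc h \<longrightarrow> f1 j \<noteq> 1" "\<not> v1 \<Longrightarrow> \<forall>j. 0 < j \<and> j < Suc h \<longrightarrow> f1 j \<noteq> 2"
    using Suc.prems(4,5) by (auto simp: u1_def v1_def f1_def less_Suc_eq)
  have o: "of_bool u1 + occ N 1 f1 = of_bool u + occ N 1 f" "of_bool v1 + occ N 2 f1 = of_bool v + occ N 2 f"
    using occ_upd[OF h(4,1), of f 1] occ_upd[OF h(4,1), of f 2] fh by (auto simp: u1_def v1_def f1_def)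
  from Suc.hyps(1)[OF n t h(2,3) c] obtain u' v' f' where
    r: "mgo (N - Suc h) (Sweep u1 v1, Suc h, f1) (Sweep u' v', N, f')" and r':"maj_tape N f'"
     "of_bool u' + occ N 1 f' = of_bool u1 + occ N 1 f1" "of_bool v' + occ N 2 f' = of_bool v1 + occ N 2 f1"
     "(\<not> u' \<longrightarrow> occ N 1 f' = 0)" "(\<not> v' \<longrightarrow> occ N 2 f' = 0)" by blast
  have "mgo (N - h) (Sweep u v, h, f) (Sweep u' v', N, f')"
    using reach_Suc[OF s r] h by (simp add: Suc_diff_Suc)
  then show ?case using r' o by (intro exI[of _ u'] exI[of _ v'] exI[of _ f']) simp
qed

lemma sweep_back: "maj_tape N f \<Longrightarrow> j < N \<Longrightarrow> mgo (Suc j) (MBack, j, f) (Sweep False False, 1, f)"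
proof (induction j)
  case 0
  then show ?case by (intro reach_step) (auto simp: maj_tape_def fun_eq_iff)
next
  case (Suc j)
  then have "fstep maj_delta MHalt (MBack, Suc j, f) = (MBack, j, f)"
    by (fastforce simp: maj_tape_def fun_eq_iff)
  moreover have "mgo (Suc j) (MBack, j, f) (Sweep False False, 1, f)" using Suc by simp
  ultimately show ?case by (rule reach_Suc)
qed

text \<open>After a sweep that ends with both flags set, the flags are cleared: both totals drop by
  one and their comparison is unchanged. Otherwise one total is 0 and the answer is known.\<close>

lemma maj_loop:
  assumes "maj_tape N f"
  shows "\<exists>f'. mgo ((of_bool u + occ N 1 f + 1) * (2 * N + 2)) (Sweep u v, 1, f) (MHalt, N, f') \<and>
     f' N = (if of_bool u + occ N 1 f \<le> of_bool v + occ N 2 f then 2 else 1) \<and> f' (Suc N) = 0"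
  using assms
proof (induction "of_bool u + occ N 1 f" arbitrary: u v f rule: less_induct)
  case less
  have N: "1 \<le> N" using less.prems by (simp add: maj_tape_def)
  obtain u' v' f' where s: "mgo (N - 1) (Sweep u v, 1, f) (Sweep u' v', N, f')" "maj_tape N f'"
     "of_bool u' + occ N 1 f' = of_bool u + occ N 1 f" "of_bool v' + occ N 2 f' = of_bool v + occ N 2 f"
     "\<not> u' \<longrightarrow> occ N 1 f' = 0" "\<not> v' \<longrightarrow> occ N 2 f' = 0"
    using sweep[OF less.prems, of 1 u v] N by auto
  have z: "f' N = 0" "f' (Suc N) = 0" using s(2) by (auto simp: maj_tape_def)
  show ?case
  proof (cases "u' \<and> v'")
    case False
    define w where "w = (if of_bool u + occ N 1 f \<le> of_bool v + occ N 2 f then 2 else 1 :: nat)"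
    have "fstep maj_delta MHalt (Sweep u' v', N, f') = (MHalt, N, f'(N := w))"
      using False z s(3-6) by (auto simp: w_def)
    from reach_trans[OF s(1) reach_step[OF this, of 1]]
    have "mgo ((of_bool u + occ N 1 f + 1) * (2 * N + 2)) (Sweep u v, 1, f) (MHalt, N, f'(N := w))"
      using N by simp
    then show ?thesis using z by (intro exI[of _ "f'(N := w)"]) (simp add: w_def)
  next
    case True
    have st: "fstep maj_delta MHalt (Sweep u' v', N, f') = (MBack, N - 1, f')"
      using True z by (auto simp: fun_eq_iff)
    have b: "mgo N (MBack, N - 1, f') (Sweep False False, 1, f')"
      using sweep_back[OF s(2), of "N - 1"] N by simp
    have d: "of_bool u + occ N 1 f = Suc (occ N 1 f')" "of_bool v + occ N 2 f = Suc (occ N 2 f')"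
      using s(3,4) True by auto
    have "mgo N (Sweep u v, 1, f) (MBack, N - 1, f')"
      by (rule reach_trans[OF s(1) reach_step[OF st, of 1]]) (use N in auto)
    from reach_trans[OF this b] have p: "mgo (2 * N) (Sweep u v, 1, f) (Sweep False False, 1, f')" by simp
    obtain g where g: "mgo ((occ N 1 f' + 1) * (2 * N + 2)) (Sweep False False, 1, f') (MHalt, N, g)"
       "g N = (if occ N 1 f' \<le> occ N 2 f' then 2 else 1)" "g (Suc N) = 0"
      using less.hyps[of False f' False] s(2) d by auto
    have "mgo ((of_bool u + occ N 1 f + 1) * (2 * N + 2)) (Sweep u v, 1, f) (MHalt, N, g)"
      by (rule reach_trans[OF p g(1)]) (simp only: d, simp)
    then show ?thesis using g(2,3) unfolding d by (intro exI[of _ g]) simp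
  qed
qed

text \<open>Turns a comparison of lengths into a majority question: the parser will emit
  \<open>True\<close> for each bit of the bound and \<open>False\<close> for each bit of the
  witness.\<close>

definition Maj :: lang where
  "Maj = {s. length (filter Not s) \<le> length (filter (\<lambda>b. b) s)}"

lemma occ_init:
  assumes "v = enc_bit c"
  shows "occ (Suc (length s)) v ((gtape 0 1 2 (b # s))(0 := 3)) = length (filter (\<lambda>a. a = c) s)"
proof -
  have "{j. 0 < j \<and> j < Suc (length s) \<and> ((gtape 0 1 2 (b # s))(0 := 3)) j = v} =
     Suc ` {i. i < length s \<and> s ! i = c}"
  proof (intro set_eqI iffI)
    fix j assume j: "j \<in> {j. 0 < j \<and> j < Suc (length s) \<and> ((gtape 0 1 2 (b # s))(0 := 3)) j = v}"
    then obtain i where "j = Suc i" by (cases j) auto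
    then show "j \<in> Suc ` {i. i < length s \<and> s ! i = c}"
      using j assms by (auto simp: gtape_def enc_bit_def split: if_splits)
  qed (use assms in \<open>auto simp: gtape_def enc_bit_def\<close>)
  then show ?thesis by (simp add: occ_def length_filter_conv_card card_image)
qed

lemma in_P_Maj: "in_P Maj"
proof (rule in_P_generic[where \<delta> = maj_delta and ?q0.0 = MStart and qh = MHalt and Q = UNIV and S = "{..<5}"
        and z = 0 and ?s0.0 = 1 and ?s1.0 = 2 and p = "\<lambda>n. 1 + (1 + n + 1) * (2 * n + 2)"])
  have "q \<in> {MStart, MHalt, MBack} \<union> (\<lambda>(u, v). Sweep u v) ` UNIV" for q
    by (cases q) auto
  then have "UNIV = {MStart, MHalt, MBack} \<union> (\<lambda>(u, v). Sweep u v) ` UNIV" by blast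
  moreover have "finite ({MStart, MHalt, MBack} \<union> (\<lambda>(u, v). Sweep u v) ` UNIV)" by simp
  ultimately show "finite (UNIV :: maj_state set)" by simp
  show "polybd (\<lambda>n. 1 + (1 + n + 1) * (2 * n + 2))"
    by (intro polybd_add polybd_mult polybd_const polybd_id)
  show "fst (maj_delta q a) \<in> UNIV \<and> fst (snd (maj_delta q a)) \<in> {..<5}" if "a \<in> {..<5}" for q a
    using that by (cases q) auto
  fix x
  show "\<exists>t \<le> 1 + (1 + length x + 1) * (2 * length x + 2). \<exists>h f.
      (fstep maj_delta MHalt ^^ t) (MStart, 0, gtape 0 1 2 x) = (MHalt, h, f)
       \<and> f h = (if x \<in> Maj then 2 else 1) \<and> f (Suc h) \<noteq> 1 \<and> f (Suc h) \<noteq> 2"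
  proof (cases x)
    case Nil
    then show ?thesis by (intro exI[of _ 1]) (auto simp: gtape_def Maj_def)
  next
    case (Cons b s)
    let ?N = "Suc (length s)" and ?f = "(gtape 0 1 2 x)(0 := 3)"
    have st: "fstep maj_delta MHalt (MStart, 0, gtape 0 1 2 x) = (Sweep (\<not> b) b, 1, ?f)"
      by (auto simp: Cons gtape_def)
    have t: "maj_tape ?N ?f" by (auto simp: maj_tape_def gtape_def Cons)
    have F: "of_bool (\<not> b) + occ ?N 1 ?f = length (filter Not x)"
      unfolding Cons using occ_init[of 1 False s b] by (simp add: enc_bit_def)
    have T: "of_bool b + occ ?N 2 ?f = length (filter (\<lambda>b. b) x)"
      unfolding Cons using occ_init[of 2 True s b] by (simp add: enc_bit_def)
    from maj_loop[OF t, of "\<not> b" b] obtain f' where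
      l: "mgo ((length (filter Not x) + 1) * (2 * ?N + 2)) (Sweep (\<not> b) b, 1, ?f) (MHalt, ?N, f')"
      "f' ?N = (if x \<in> Maj then 2 else 1)" "f' (Suc ?N) = 0"
      unfolding F T Maj_def by auto
    have "mgo (1 + (1 + length x + 1) * (2 * length x + 2)) (MStart, 0, gtape 0 1 2 x) (MHalt, ?N, f')"
    proof (rule reach_trans[OF reach_step[OF st order_refl] l(1)])
      show "1 + (length (filter Not x) + 1) * (2 * ?N + 2) \<le> 1 + (1 + length x + 1) * (2 * length x + 2)"
        using length_filter_le[of Not x] by (intro add_mono mult_le_mono) (auto simp: Cons)
    qed
    then show ?thesis using l(2,3) unfolding reach_def by auto
  qed
qed auto

section \<open>Parsing instances and a combined NP language\<close>

definition dbl :: "bool list \<Rightarrow> bool list" where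
  "dbl x = concat (map (\<lambda>b. [b, b]) x)"

lemma dbl_simps [simp]: "dbl [] = []" "dbl (b # x) = b # b # dbl x" "dbl (x @ y) = dbl x @ dbl y"
  by (auto simp: dbl_def)

lemma length_dbl [simp]: "length (dbl x) = 2 * length x"
  by (induction x) auto

lemma pair_enc_dbl: "pair_enc x w = dbl x @ False # True # w"
  by (simp add: pair_enc_def dbl_def)

text \<open>Nesting to the right makes adding a first field a single \<open>pair_enc\<close>, which
  is how input and advice combine to an instance.\<close>

definition enc_fields :: "bool list list \<Rightarrow> bool list" where
  "enc_fields fs = foldr pair_enc fs []"

lemma enc_fields_simps [simp]: "enc_fields [] = []" "enc_fields (g # fs) = dbl g @ False # True # enc_fields fs"
  by (simp_all add: enc_fields_def pair_enc_dbl)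

text \<open>A state \<open>(m, k, p, b)\<close> of the parser of \<open>pair_enc (enc_fields fs) w\<close>: \<open>m\<close> says whether \<open>w\<close> has been
  reached, \<open>k\<close> is the index of the current field, \<open>p\<close> the position in the current block (of length 4
  before \<open>w\<close>, where every bit occurs four times, and of length 2 in \<open>w\<close>), and \<open>b\<close> the last bit read
  (at position 3: whether the block is a separator).\<close>
type_synonym pstate = "bool \<times> nat \<times> nat \<times> bool"

text \<open>Before \<open>w\<close>, a data bit is a block bbbb and a field separator is 0011; a
  block starting with 01 is the separator in front of \<open>w\<close>. The index is capped at 6,
  the number of fields, to keep the state set finite.\<close>

fun pnext :: "pstate \<Rightarrow> bool \<Rightarrow> pstate" where
  "pnext (m, k, p, b) c =
     (if m then (if p = 0 then (True, k, 1, c)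
                 else if c = b then (True, k, 0, False) else (True, min 6 (Suc k), 0, False))
      else if p = 0 then (False, k, 1, c)
      else if p = 1 then (if c = b then (False, k, 2, c) else (True, 0, 0, False))
      else if p = 2 then (False, k, 3, c \<noteq> b)
      else (False, if b then min 6 (Suc k) else k, 0, False))"

text \<open>Before \<open>w\<close>, the second and the fourth bit of a block are emitted: bbbb
  becomes bb and 0011 becomes 01. The output is thus already \<open>pair_enc\<close> of field
  \<open>i\<close> and witness \<open>j\<close>, ready for a verifier.\<close>

fun pick :: "nat \<Rightarrow> nat \<Rightarrow> pstate \<Rightarrow> bool \<Rightarrow> bool option" where
  "pick i j (m, k, p, b) c =
     (if m then (if k = j \<and> p = 1 \<and> c = b then Some c else None)
      else if k = i \<and> p = 2 then Some b
      else if k = i \<and> p = 3 then Some c else None)"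

fun pick_len :: "nat \<Rightarrow> nat \<Rightarrow> pstate \<Rightarrow> bool \<Rightarrow> bool option" where
  "pick_len i j (m, k, p, b) c =
     (if m then (if k = j \<and> p = 1 \<and> c = b then Some False else None)
      else if k = i \<and> p = 3 \<and> \<not> b then Some True else None)"

text \<open>Total on all strings, so that the format of a witness needs no check. The choice
  \<open>pick 0\<close> is immaterial, as all \<open>pick i j\<close> agree once \<open>w\<close>
  has been reached.\<close>

definition wit :: "nat \<Rightarrow> bool list \<Rightarrow> bool list" where
  "wit j w = transd pnext (pick 0 j) (True, 0, 0, False) w"

lemma pick_wit: "transd pnext (pick i j) (True, k, p, b) w = transd pnext (pick 0 j) (True, k, p, b) w"
  by (induction w arbitrary: k p b) auto

lemma pick_len_wit: "transd pnext (pick_len i j) (True, k, p, b) w =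
    replicate (length (transd pnext (pick 0 j) (True, k, p, b) w)) False"
  by (induction w arbitrary: k p b) auto

lemma pick_block: "transd pnext (pick i j) (False, k, 0, False) (dbl (dbl g) @ r) =
    (if k = i then dbl g else []) @ transd pnext (pick i j) (False, k, 0, False) r"
  by (induction g) auto

lemma pick_len_block: "transd pnext (pick_len i j) (False, k, 0, False) (dbl (dbl g) @ r) =
    (if k = i then replicate (length g) True else []) @ transd pnext (pick_len i j) (False, k, 0, False) r"
  by (induction g) auto

lemma pick_fields:
  "k + length fs \<le> 6 \<Longrightarrow> transd pnext (pick i j) (False, k, 0, False) (dbl (enc_fields fs) @ False # True # w) =
    (if k \<le> i \<and> i < k + length fs then dbl (fs ! (i - k)) @ [False, True] else []) @ wit j w"
proof (induction fs arbitrary: k)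
  case Nil
  then show ?case using pick_wit[of i j 0 0 False w] by (auto simp: wit_def)
next
  case (Cons g fs)
  have IH: "transd pnext (pick i j) (False, Suc k, 0, False) (dbl (enc_fields fs) @ False # True # w) =
    (if Suc k \<le> i \<and> i < Suc k + length fs then dbl (fs ! (i - Suc k)) @ [False, True] else []) @ wit j w"
    using Cons by simp
  have "min 6 (Suc k) = Suc k" using Cons.prems by simp
  then show ?case using IH by (auto simp: pick_block nth_Cons')
qed

lemma pick_len_fields:
  "k + length fs \<le> 6 \<Longrightarrow> transd pnext (pick_len i j) (False, k, 0, False) (dbl (enc_fields fs) @ False # True # w) =
    (if k \<le> i \<and> i < k + length fs then replicate (length (fs ! (i - k))) True else []) @ replicate (length (wit j w)) False"
proof (induction fs arbitrary: k)
  case Nil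
  then show ?case using pick_len_wit[of i j 0 0 False w] by (auto simp: wit_def)
next
  case (Cons g fs)
  have IH: "transd pnext (pick_len i j) (False, Suc k, 0, False) (dbl (enc_fields fs) @ False # True # w) =
    (if Suc k \<le> i \<and> i < Suc k + length fs then replicate (length (fs ! (i - Suc k))) True else []) @ replicate (length (wit j w)) False"
    using Cons by simp
  have "min 6 (Suc k) = Suc k" using Cons.prems by simp
  then show ?case using IH by (auto simp: pick_len_block nth_Cons')
qed

lemma wit_block: "transd pnext (pick 0 j) (True, k, 0, False) (dbl g @ r) =
    (if k = j then g else []) @ transd pnext (pick 0 j) (True, k, 0, False) r"
  by (induction g) auto

lemma wit_fields_aux:
  "k + length ws \<le> 6 \<Longrightarrow> transd pnext (pick 0 j) (True, k, 0, False) (enc_fields ws) =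
    (if k \<le> j \<and> j < k + length ws then ws ! (j - k) else [])"
proof (induction ws arbitrary: k)
  case (Cons g ws)
  have IH: "transd pnext (pick 0 j) (True, Suc k, 0, False) (enc_fields ws) =
    (if Suc k \<le> j \<and> j < Suc k + length ws then ws ! (j - Suc k) else [])"
    using Cons by simp
  have "min 6 (Suc k) = Suc k" using Cons.prems by simp
  then show ?case using IH by (auto simp: wit_block nth_Cons')
qed auto

lemma wit_fields: "length ws \<le> 6 \<Longrightarrow> j < length ws \<Longrightarrow> wit j (enc_fields ws) = ws ! j"
  using wit_fields_aux[of 0 ws j] by (simp add: wit_def)

abbreviation "pstart \<equiv> (False, 0, 0, False)"

lemma in_P_parse:
  assumes "\<And>b. out pstart b = None" "in_P V1" "in_P V2" "in_P V3"
  shows "in_P {t. if transd pnext out pstart t \<in> V1 then t \<in> V2 else t \<in> V3}"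
proof (rule in_P_branch[where K = "UNIV \<times> {..6} \<times> {..3} \<times> UNIV"])
  show "pnext s b \<in> UNIV \<times> {..6} \<times> {..3} \<times> UNIV" if "s \<in> UNIV \<times> {..6} \<times> {..3} \<times> UNIV" for s b
    using that by (cases s) (auto simp: min_def)
qed (use assms in auto)

definition vfields :: "nat \<Rightarrow> nat \<Rightarrow> lang \<Rightarrow> bool list \<Rightarrow> bool" where
  "vfields i j V t \<longleftrightarrow> transd pnext (pick i j) pstart t \<in> V"

definition lfields :: "nat \<Rightarrow> nat \<Rightarrow> bool list \<Rightarrow> bool" where
  "lfields i j t \<longleftrightarrow> transd pnext (pick_len i j) pstart t \<in> Maj"

lemma vfields_iff:
  assumes "length fs \<le> 6" "i < length fs"
  shows "vfields i j V (pair_enc (enc_fields fs) w) \<longleftrightarrow> pair_enc (fs ! i) (wit j w) \<in> V"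
  using pick_fields[of 0 fs i j w] assms by (simp add: vfields_def pair_enc_dbl)

lemma lfields_iff:
  assumes "length fs \<le> 6" "i < length fs"
  shows "lfields i j (pair_enc (enc_fields fs) w) \<longleftrightarrow> length (wit j w) \<le> length (fs ! i)"
  using pick_len_fields[of 0 fs i j w] assms by (simp add: lfields_def pair_enc_dbl Maj_def)

lemma in_P_vfields:
  assumes "in_P V" "in_P {t. P t}" "in_P {t. R t}"
  shows "in_P {t. if vfields i j V t then P t else R t}"
proof -
  have "pick i j pstart b = None" for b by simp
  from in_P_parse[where out = "pick i j", OF this assms] show ?thesis
    by (simp only: vfields_def mem_Collect_eq)
qed

lemma in_P_lfields:
  assumes "in_P {t. P t}" "in_P {t. R t}"
  shows "in_P {t. if lfields i j t then P t else R t}"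
proof -
  have "pick_len i j pstart b = None" for b by simp
  from in_P_parse[where out = "pick_len i j", OF this in_P_Maj assms] show ?thesis
    by (simp only: lfields_def mem_Collect_eq)
qed

text \<open>The last three fields are, in unary, the bounds on the lengths of the witnesses for \<open>y, x, z\<close>; the
  verifier compares the witnesses with them instead of computing polynomials.\<close>
lemma in_NP_combine:
  assumes "in_NP B" "in_NP L"
  shows "\<exists>C c k d l. in_NP C \<and> (\<forall>y x z. enc_fields [y, x, z,
      replicate (c * length y ^ k + c) False, replicate (d * length x ^ l + d) False,
      replicate (d * length z ^ l + d) False] \<in> C \<longleftrightarrow> (y \<in> B \<and> x \<in> L) \<or> z \<in> L)"
proof -
  obtain VB c k where B: "in_P VB"
    "\<And>x. x \<in> B \<longleftrightarrow> (\<exists>w. length w \<le> c * length x ^ k + c \<and> pair_enc x w \<in> VB)"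
    using assms(1) unfolding in_NP_def by blast
  obtain VL d l where L: "in_P VL"
    "\<And>x. x \<in> L \<longleftrightarrow> (\<exists>w. length w \<le> d * length x ^ l + d \<and> pair_enc x w \<in> VL)"
    using assms(2) unfolding in_NP_def by blast
  define X where "X t \<longleftrightarrow> (if vfields 2 2 VL t then if lfields 5 2 t then True else False else False)" for t
  \<comment> \<open>A disjunction written with branches: every test of the first disjunct that fails
    falls through to \<open>X\<close>.\<close>
  define V where "V t \<longleftrightarrow> (if vfields 0 0 VB t then if lfields 3 0 t then if vfields 1 1 VL t then
      if lfields 4 1 t then True else X t else X t else X t else X t)" for t
  have "in_P {t. X t}" unfolding X_def by (intro in_P_vfields in_P_lfields in_P_const L(1))
  then have PV: "in_P {t. V t}" unfolding V_def by (intro in_P_vfields in_P_lfields in_P_const L(1) B(1))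
  \<comment> \<open>A linear bound is enough: the instance contains the witness bounds in unary and
    is therefore longer than the encoding of three witnesses that respect them.\<close>
  define C where "C = {u. \<exists>w. length w \<le> 6 * length u ^ 1 + 6 \<and> pair_enc u w \<in> {t. V t}}"
  have "in_NP C" unfolding in_NP_def C_def using PV by blast
  moreover have "enc_fields [y, x, z, replicate (c * length y ^ k + c) False, replicate (d * length x ^ l + d) False,
      replicate (d * length z ^ l + d) False] \<in> C \<longleftrightarrow> (y \<in> B \<and> x \<in> L) \<or> z \<in> L" (is "?u \<in> C \<longleftrightarrow> ?R") for y x z
  proof -
    let ?fs = "[y, x, z, replicate (c * length y ^ k + c) False, replicate (d * length x ^ l + d) False,
      replicate (d * length z ^ l + d) False]"
    have v: "V (pair_enc ?u w) \<longleftrightarrow>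
       (length (wit 0 w) \<le> c * length y ^ k + c \<and> pair_enc y (wit 0 w) \<in> VB \<and>
        length (wit 1 w) \<le> d * length x ^ l + d \<and> pair_enc x (wit 1 w) \<in> VL) \<or>
       (length (wit 2 w) \<le> d * length z ^ l + d \<and> pair_enc z (wit 2 w) \<in> VL)" for w
      unfolding V_def X_def by (simp add: vfields_iff lfields_iff del: enc_fields_simps)
    show ?thesis
    proof
      assume "?u \<in> C"
      then obtain w where "V (pair_enc ?u w)" unfolding C_def by blast
      then show ?R unfolding v B(2) L(2) by blast
    next
      assume R: ?R
      \<comment> \<open>Witnesses that the valid disjunct does not use are taken empty.\<close>
      obtain w1 w2 w3 where w: "length w1 \<le> c * length y ^ k + c" "length w2 \<le> d * length x ^ l + d"
        "length w3 \<le> d * length z ^ l + d"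
        "(pair_enc y w1 \<in> VB \<and> pair_enc x w2 \<in> VL) \<or> pair_enc z w3 \<in> VL"
        using R unfolding B(2) L(2) by (metis le0 list.size(3))
      have "V (pair_enc ?u (enc_fields [w1, w2, w3]))"
        unfolding v using w by (simp add: wit_fields del: enc_fields_simps)
      moreover have "length (enc_fields [w1, w2, w3]) \<le> 6 * length ?u ^ 1 + 6"
        using w(1-3) by simp
      ultimately show "?u \<in> C" unfolding C_def by blast
    qed
  qed
  ultimately show ?thesis by blast
qed

section \<open>Straight-line programs simulating Turing machines\<close>

definition slp :: "nat \<Rightarrow> nat \<Rightarrow> (bool list \<Rightarrow> bool) set \<Rightarrow> bool" where
  "slp n s F \<longleftrightarrow> (\<exists>gs. length gs \<le> s \<and> (\<forall>i < length gs. gate_refs (gs ! i) \<subseteq> {..<n + i}) \<and>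
     (\<forall>g \<in> F. \<exists>i < n + length gs. \<forall>xs. length xs = n \<longrightarrow> eval_gates xs gs ! i = g xs))"

lemma length_eval_gates [simp]: "length (eval_gates vs gs) = length vs + length gs"
  by (induction gs arbitrary: vs) auto

lemma eval_gates_snoc: "eval_gates vs (gs @ [g]) = eval_gates vs gs @ [gate_val (eval_gates vs gs) g]"
  by (induction gs arbitrary: vs) auto

lemma slp_mono: "slp n s F \<Longrightarrow> s \<le> s' \<Longrightarrow> F' \<subseteq> F \<Longrightarrow> slp n s' F'"
  unfolding slp_def by (elim exE, rule exI) (auto intro: le_trans)

lemma slp_extend:
  assumes gs: "length gs \<le> s" "\<forall>i < length gs. gate_refs (gs ! i) \<subseteq> {..<n + i}"
      "\<forall>g \<in> F. \<exists>i < n + length gs. \<forall>xs. length xs = n \<longrightarrow> eval_gates xs gs ! i = g xs"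
    and G: "gate_refs G \<subseteq> {..<n + length gs}" "\<And>xs. length xs = n \<Longrightarrow> gate_val (eval_gates xs gs) G = h xs"
  shows "slp n (s + 1) (insert h F)"
  unfolding slp_def
proof (intro exI[of _ "gs @ [G]"] conjI ballI)
  show "length (gs @ [G]) \<le> s + 1" using gs(1) by simp
  show "\<forall>i < length (gs @ [G]). gate_refs ((gs @ [G]) ! i) \<subseteq> {..<n + i}"
    using gs(2) G(1) by (auto simp: nth_append less_Suc_eq)
  fix g assume g: "g \<in> insert h F"
  show "\<exists>i < n + length (gs @ [G]). \<forall>xs. length xs = n \<longrightarrow> eval_gates xs (gs @ [G]) ! i = g xs"
  proof (cases "g = h")
    case True
    then show ?thesis using G(2)
      by (intro exI[of _ "n + length gs"]) (auto simp: eval_gates_snoc nth_append)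
  next
    case False
    then obtain i where "i < n + length gs" "\<forall>xs. length xs = n \<longrightarrow> eval_gates xs gs ! i = g xs"
      using gs(3) g by blast
    then show ?thesis by (intro exI[of _ i]) (auto simp: eval_gates_snoc nth_append)
  qed
qed

lemma slp_const: "slp n s F \<Longrightarrow> slp n (s + 1) (insert (\<lambda>xs. b) F)"
  unfolding slp_def[of n s F] by (elim exE conjE, rule slp_extend[where G = "GConst b"]) auto

lemma slp_not:
  assumes "slp n s F" "g \<in> F" shows "slp n (s + 1) (insert (\<lambda>xs. \<not> g xs) F)"
proof -
  obtain gs where gs: "length gs \<le> s" "\<forall>i < length gs. gate_refs (gs ! i) \<subseteq> {..<n + i}"
     "\<forall>g \<in> F. \<exists>i < n + length gs. \<forall>xs. length xs = n \<longrightarrow> eval_gates xs gs ! i = g xs"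
    using assms(1) unfolding slp_def by blast
  obtain i where "i < n + length gs" "\<forall>xs. length xs = n \<longrightarrow> eval_gates xs gs ! i = g xs"
    using gs(3) assms(2) by blast
  then show ?thesis by (intro slp_extend[OF gs, where G = "GNot i"]) auto
qed

lemma slp_binary:
  assumes "slp n s F" "g \<in> F" "h \<in> F"
  shows "slp n (s + 1) (insert (\<lambda>xs. g xs \<and> h xs) F)" "slp n (s + 1) (insert (\<lambda>xs. g xs \<or> h xs) F)"
proof -
  obtain gs where gs: "length gs \<le> s" "\<forall>i < length gs. gate_refs (gs ! i) \<subseteq> {..<n + i}"
     "\<forall>g \<in> F. \<exists>i < n + length gs. \<forall>xs. length xs = n \<longrightarrow> eval_gates xs gs ! i = g xs"
    using assms(1) unfolding slp_def by blast
  obtain i where i: "i < n + length gs" "\<forall>xs. length xs = n \<longrightarrow> eval_gates xs gs ! i = g xs"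
    using gs(3) assms(2) by blast
  obtain j where j: "j < n + length gs" "\<forall>xs. length xs = n \<longrightarrow> eval_gates xs gs ! j = h xs"
    using gs(3) assms(3) by blast
  show "slp n (s + 1) (insert (\<lambda>xs. g xs \<and> h xs) F)"
    using i j by (intro slp_extend[OF gs, where G = "GAnd i j"]) auto
  show "slp n (s + 1) (insert (\<lambda>xs. g xs \<or> h xs) F)"
    using i j by (intro slp_extend[OF gs, where G = "GOr i j"]) auto
qed

definition inputs :: "nat \<Rightarrow> (bool list \<Rightarrow> bool) set" where
  "inputs n = (\<lambda>i xs. xs ! i) ` {..<n}"

lemma slp_inputs: "slp n 0 (inputs n)"
  unfolding slp_def inputs_def by (rule exI[of _ "[]"]) auto

text \<open>Cost relative to wires already present. Quantifying over all larger \<open>F'\<close>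
  allows the extension inside any program, so costs add under composition and shared parts are paid
  once.\<close>

definition scost :: "nat \<Rightarrow> nat \<Rightarrow> (bool list \<Rightarrow> bool) set \<Rightarrow> (bool list \<Rightarrow> bool) set \<Rightarrow> bool" where
  "scost n c F G \<longleftrightarrow> (\<forall>s F'. F \<subseteq> F' \<longrightarrow> slp n s F' \<longrightarrow> slp n (s + c) (F' \<union> G))"

lemma scost_mono:
  assumes "scost n c F G" "c \<le> d" "F \<subseteq> F1" "G1 \<subseteq> G"
  shows "scost n d F1 G1"
  unfolding scost_def
proof (intro allI impI)
  fix s F' assume F': "F1 \<subseteq> F'" "slp n s F'"
  then have "slp n (s + c) (F' \<union> G)" using assms(1,3) unfolding scost_def by blast
  then show "slp n (s + d) (F' \<union> G1)" by (rule slp_mono) (use assms in auto)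
qed

lemma scost_subset:
  assumes "G \<subseteq> F" shows "scost n c F G"
  unfolding scost_def
proof (intro allI impI)
  fix s F' assume F': "F \<subseteq> F'" "slp n s F'"
  show "slp n (s + c) (F' \<union> G)" by (rule slp_mono[OF F'(2)]) (use assms F'(1) in auto)
qed

lemma scost_trans:
  assumes "scost n c F G" "scost n d (F \<union> G) H"
  shows "scost n (c + d) F (G \<union> H)"
  unfolding scost_def
proof (intro allI impI)
  fix s F' assume F': "F \<subseteq> F'" "slp n s F'"
  then have "slp n (s + c) (F' \<union> G)" using assms(1) unfolding scost_def by blast
  moreover have "F \<union> G \<subseteq> F' \<union> G" using F'(1) by blast
  ultimately have "slp n (s + c + d) (F' \<union> G \<union> H)" using assms(2) unfolding scost_def by blast
  then show "slp n (s + (c + d)) (F' \<union> (G \<union> H))" by (simp add: add.assoc Un_assoc)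
qed

lemma scost_through:
  assumes "scost n c F G" "scost n d G H" shows "scost n (c + d) F H"
proof -
  have "scost n d (F \<union> G) H" by (rule scost_mono[OF assms(2)]) auto
  from scost_trans[OF assms(1) this] show ?thesis by (rule scost_mono) auto
qed

lemma scost_step:
  assumes "scost n c F G" "\<And>s F'. F \<union> G \<subseteq> F' \<Longrightarrow> slp n s F' \<Longrightarrow> slp n (s + 1) (insert h F')"
  shows "scost n (c + 1) F {h}"
proof -
  have "scost n 1 (F \<union> G) {h}" using assms(2) unfolding scost_def by simp
  from scost_trans[OF assms(1) this] show ?thesis by (rule scost_mono) auto
qed

lemma scost_const: "scost n 1 F {\<lambda>xs. b}"
  using slp_const by (simp add: scost_def)

lemma scost_not: "scost n c F {g} \<Longrightarrow> scost n (c + 1) F {\<lambda>xs. \<not> g xs}"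
  by (erule scost_step) (rule slp_not, auto)

lemma scost_union:
  assumes "scost n a F G" "scost n b F H" shows "scost n (a + b) F (G \<union> H)"
proof (rule scost_trans[OF assms(1)])
  show "scost n b (F \<union> G) H" by (rule scost_mono[OF assms(2)]) auto
qed

lemma scost_and:
  assumes "scost n a F {g}" "scost n b F {h}"
  shows "scost n (a + b + 1) F {\<lambda>xs. g xs \<and> h xs}"
proof (rule scost_step[OF scost_union[OF assms]])
  fix s F' assume F': "F \<union> ({g} \<union> {h}) \<subseteq> F'" "slp n s F'"
  show "slp n (s + 1) (insert (\<lambda>xs. g xs \<and> h xs) F')"
    by (rule slp_binary(1)[OF F'(2)]) (use F'(1) in auto)
qed

lemma scost_or:
  assumes "scost n a F {g}" "scost n b F {h}"
  shows "scost n (a + b + 1) F {\<lambda>xs. g xs \<or> h xs}"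
proof (rule scost_step[OF scost_union[OF assms]])
  fix s F' assume F': "F \<union> ({g} \<union> {h}) \<subseteq> F'" "slp n s F'"
  show "slp n (s + 1) (insert (\<lambda>xs. g xs \<or> h xs) F')"
    by (rule slp_binary(2)[OF F'(2)]) (use F'(1) in auto)
qed

lemma scost_cong:
  assumes "scost n c F {g}" "\<And>xs. length xs = n \<Longrightarrow> g xs = h xs"
  shows "scost n c F {h}"
  unfolding scost_def
proof (intro allI impI)
  fix s F' assume "F \<subseteq> F'" "slp n s F'"
  then have "slp n (s + c) (F' \<union> {g})" using assms(1) unfolding scost_def by blast
  then show "slp n (s + c) (F' \<union> {h})" using assms(2) unfolding slp_def by (simp add: ball_Un)
qed

lemma scost_image: "finite I \<Longrightarrow> (\<And>i. i \<in> I \<Longrightarrow> scost n c F {g i}) \<Longrightarrow> scost n (card I * c) F (g ` I)"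
proof (induction I rule: finite_induct)
  case (insert i I)
  then show ?case using scost_union[of n c F "{g i}" "card I * c" "g ` I"] by simp
qed (simp add: scost_subset)

text \<open>One disjunction gate per index, and one constant gate for the empty disjunction.\<close>

lemma scost_Bex: "finite I \<Longrightarrow> (\<And>i. i \<in> I \<Longrightarrow> scost n c F {g i}) \<Longrightarrow>
    scost n (card I * (c + 1) + 1) F {\<lambda>xs. \<exists>i \<in> I. g i xs}"
proof (induction I rule: finite_induct)
  case empty
  then show ?case using scost_const[of n F False] by simp
next
  case (insert i I)
  have "scost n (c + (card I * (c + 1) + 1) + 1) F {\<lambda>xs. g i xs \<or> (\<exists>i \<in> I. g i xs)}"
    using insert by (intro scost_or) auto
  then show ?case using insert by (simp add: algebra_simps)
qed

lemma scost_Ball: "finite I \<Longrightarrow> (\<And>i. i \<in> I \<Longrightarrow> scost n c F {g i}) \<Longrightarrow>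
    scost n (card I * (c + 1) + 1) F {\<lambda>xs. \<forall>i \<in> I. g i xs}"
proof (induction I rule: finite_induct)
  case empty
  then show ?case using scost_const[of n F True] by simp
next
  case (insert i I)
  have "scost n (c + (card I * (c + 1) + 1) + 1) F {\<lambda>xs. g i xs \<and> (\<forall>i \<in> I. g i xs)}"
    using insert by (intro scost_and) auto
  then show ?case using insert by (simp add: algebra_simps)
qed

lemma CC_le:
  assumes "scost n c (inputs n) {g}" shows "CC n g \<le> c"
proof -
  have "slp n (0 + c) (inputs n \<union> {g})" using assms slp_inputs unfolding scost_def by blast
  then obtain gs i where gs: "length gs \<le> c" "\<forall>i < length gs. gate_refs (gs ! i) \<subseteq> {..<n + i}"
    "i < n + length gs" "\<forall>xs. length xs = n \<longrightarrow> eval_gates xs gs ! i = g xs"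
    unfolding slp_def by auto
  then have "circuit_computes n (gs, i) g"
    by (auto simp: circuit_computes_def wf_circuit_def circuit_eval_def)
  then have "CC n g \<le> length gs"
    unfolding CC_def by (intro Least_le exI[of _ "(gs, i)"]) (simp add: circuit_size_def)
  then show ?thesis using gs(1) by simp
qed

text \<open>In the applications each position is a constant or an input bit: one field of the
  instance is free and the others are hardwired.\<close>

definition avail :: "nat \<Rightarrow> nat \<Rightarrow> (bool list \<Rightarrow> bool list) \<Rightarrow> bool" where
  "avail n U u \<longleftrightarrow> (\<forall>xs. length xs = n \<longrightarrow> length (u xs) = U) \<and>
     (\<forall>i < U. scost n 1 (inputs n) {\<lambda>xs. u xs ! i})"

lemma avail_const: "avail n (length v) (\<lambda>xs. v)"
  by (simp add: avail_def scost_const[unfolded One_nat_def])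

lemma avail_id: "avail n n (\<lambda>xs. xs)"
  by (auto simp: avail_def inputs_def intro!: scost_subset)

lemma avail_append:
  assumes "avail n U u" "avail n V v" shows "avail n (U + V) (\<lambda>xs. u xs @ v xs)"
  unfolding avail_def
proof (intro conjI allI impI)
  fix i assume i: "i < U + V"
  show "scost n 1 (inputs n) {\<lambda>xs. (u xs @ v xs) ! i}"
  proof (cases "i < U")
    case True
    then have "scost n 1 (inputs n) {\<lambda>xs. u xs ! i}" using assms(1) by (simp add: avail_def)
    then show ?thesis using True assms(1) by (rule_tac scost_cong) (auto simp: avail_def nth_append)
  next
    case False
    then have "scost n 1 (inputs n) {\<lambda>xs. v xs ! (i - U)}" using assms(2) i by (simp add: avail_def)
    then show ?thesis using False assms(1) by (rule_tac scost_cong) (auto simp: avail_def nth_append)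
  qed
qed (use assms in \<open>simp add: avail_def\<close>)

lemma nth_dbl: "i < 2 * length x \<Longrightarrow> dbl x ! i = x ! (i div 2)"
proof (induction x arbitrary: i)
  case (Cons b x)
  consider "i = 0" | "i = 1" | k where "i = Suc (Suc k)" by (metis One_nat_def not0_implies_Suc)
  then show ?case using Cons by cases auto
qed simp

lemma avail_dbl:
  assumes "avail n U u" shows "avail n (2 * U) (\<lambda>xs. dbl (u xs))"
  unfolding avail_def
proof (intro conjI allI impI)
  fix i assume i: "i < 2 * U"
  then have "scost n 1 (inputs n) {\<lambda>xs. u xs ! (i div 2)}" using assms by (simp add: avail_def)
  then show "scost n 1 (inputs n) {\<lambda>xs. dbl (u xs) ! i}"
    using assms i by (rule_tac scost_cong) (auto simp: avail_def nth_dbl)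
qed (use assms in \<open>simp add: avail_def\<close>)

lemma avail_field:
  assumes "avail n U u" "avail n V v"
  shows "avail n (2 * U + (2 + V)) (\<lambda>xs. dbl (u xs) @ False # True # v xs)"
  using avail_append[OF avail_dbl[OF assms(1)] avail_append[OF avail_const[of n "[False, True]"] assms(2)]]
  by simp

section \<open>The computation tableau of a Turing machine as a circuit\<close>

fun loc :: "(nat, nat) fconf \<Rightarrow> nat \<Rightarrow> nat \<times> nat option" where
  "loc (q, h, f) i = (f i, if h = i then Some q else None)"

definition nextloc :: "(nat \<Rightarrow> nat \<Rightarrow> nat \<times> nat \<times> move) \<Rightarrow> bool \<Rightarrow> nat \<times> nat option \<Rightarrow> nat \<times> nat option \<Rightarrow>
    nat \<times> nat option \<Rightarrow> nat \<times> nat option" where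
  "nextloc d first la lb lc = (case snd lb of
     Some q \<Rightarrow> if q = 1 then lb else (case d q (fst lb) of (q', b, m) \<Rightarrow>
       (b, if m = MoveS \<or> (m = MoveL \<and> first) then Some q' else None))
   | None \<Rightarrow> (fst lb, case snd la of
       Some q \<Rightarrow> if q = 1 then None else (case d q (fst la) of (q', b, m) \<Rightarrow> if m = MoveR then Some q' else None)
     | None \<Rightarrow> (case snd lc of
         Some q \<Rightarrow> if q = 1 then None else (case d q (fst lc) of (q', b, m) \<Rightarrow> if m = MoveL then Some q' else None)
       | None \<Rightarrow> None)))"

text \<open>For \<open>i = 0\<close> the left neighbour is cell 0 itself by truncated subtraction.
  This is harmless, because neighbours are consulted only if the head is not on the cell.\<close>

lemma loc_step: "loc (fstep d 1 c) i = nextloc d (i = 0) (loc c (i - 1)) (loc c i) (loc c (i + 1))"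
proof -
  obtain q h f where c: "c = (q, h, f)" by (cases c) auto
  obtain q' b m where d: "d q (f h) = (q', b, m)" by (metis prod_cases3)
  show ?thesis using d by (cases m) (auto simp: c nextloc_def)
qed

context
  fixes M :: tm and u :: "bool list \<Rightarrow> bool list"
begin

definition "conf t xs = (fstep (tm_delta M) 1 ^^ t) (0, 0, gtape 0 1 2 (u xs))"

definition "Val = {..<tm_symbols M} \<times> insert None (Some ` {..<tm_states M})"

definition "tbit t i v xs \<longleftrightarrow> loc (conf t xs) i = v"

definition "tbits t K = (\<lambda>(i, v). tbit t i v) ` ({..<K} \<times> Val)"

text \<open>A disjunction over triples of neighbouring values: two conjunction gates and one
  disjunction gate per triple, and one constant.\<close>

definition "step_cost = 3 * card Val ^ 3 + 1"

text \<open>\<open>K\<close> cells of a row depend on \<open>K + 1\<close> cells of the previous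
  row, so \<open>K + T\<close> cells are needed at time 0. There an indicator costs one available
  bit and at most one negation. Later rows are all charged the initial width.\<close>

definition "sim_cost T K = (K + T) * card Val * 2 + T * ((K + T) * card Val * step_cost)"

definition "out_cost T N = Suc T * ((card Val + 1) + ((N * (card Val + 1 + 1) + 1) + (card Val + 1) + 1) + 1 + 1) + 1"

context
  fixes n U :: nat
  assumes wf: "wf_tm M" and u: "avail n U u"
begin

lemma finite_Val: "finite Val" by (simp add: Val_def)

lemma conf_wf: "\<exists>q h f. conf t xs = (q, h, f) \<and> q < tm_states M \<and> h \<le> t \<and> (\<forall>i. f i < tm_symbols M)"
proof (induction t)
  case 0
  then show ?case using wf by (auto simp: conf_def wf_tm_def gtape_def)
next
  case (Suc t)
  then obtain q h f where c: "conf t xs = (q, h, f)" "q < tm_states M" "h \<le> t" "\<forall>i. f i < tm_symbols M" by blast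
  obtain q' b m where d: "tm_delta M q (f h) = (q', b, m)" by (metis prod_cases3)
  have "q' < tm_states M" "b < tm_symbols M" using wf c d unfolding wf_tm_def by (metis fst_conv snd_conv)+
  moreover have "shift m h \<le> Suc t" using c(3) by (cases m) auto
  moreover have "conf (Suc t) xs = fstep (tm_delta M) 1 (conf t xs)" by (simp add: conf_def)
  ultimately show ?case using c d by auto
qed

lemma loc_Val: "loc (conf t xs) i \<in> Val"
  using conf_wf[of t xs] by (auto simp: Val_def)

lemma scost_tbit: "i < K \<Longrightarrow> v \<in> Val \<Longrightarrow> scost n 0 (tbits t K) {tbit t i v}"
  by (rule scost_subset) (auto simp: tbits_def)

lemma triple_mem: "(\<exists>z \<in> I. a = fst z \<and> (b = fst (snd z) \<and> c = snd (snd z))) \<longleftrightarrow> (a, b, c) \<in> I"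
  by (metis fst_conv prod.collapse snd_conv)

lemma scost_next:
  assumes "i < K" "v \<in> Val"
  shows "scost n step_cost (tbits t (Suc K)) {tbit (Suc t) i v}"
proof -
  let ?I = "{(a, b, c). a \<in> Val \<and> b \<in> Val \<and> c \<in> Val \<and> nextloc (tm_delta M) (i = 0) a b c = v}"
  have sub: "?I \<subseteq> Val \<times> Val \<times> Val" by auto
  have fin: "finite ?I" by (rule finite_subset[OF sub]) (simp add: finite_Val)
  have "card ?I \<le> card (Val \<times> Val \<times> Val)" by (rule card_mono[OF _ sub]) (simp add: finite_Val)
  then have card: "card ?I \<le> card Val ^ 3" by (simp add: card_cartesian_product power3_eq_cube)
  have "scost n (card ?I * ((0 + (0 + 0 + 1) + 1) + 1) + 1) (tbits t (Suc K))
     {\<lambda>xs. \<exists>abc \<in> ?I. tbit t (i - 1) (fst abc) xs \<and> (tbit t i (fst (snd abc)) xs \<and> tbit t (i + 1) (snd (snd abc)) xs)}"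
    by (intro scost_Bex fin scost_and scost_tbit) (use assms(1) in auto)
  then have "scost n step_cost (tbits t (Suc K))
     {\<lambda>xs. \<exists>abc \<in> ?I. tbit t (i - 1) (fst abc) xs \<and> (tbit t i (fst (snd abc)) xs \<and> tbit t (i + 1) (snd (snd abc)) xs)}"
    by (rule scost_mono) (use card in \<open>auto simp: step_cost_def\<close>)
  then show ?thesis
  proof (rule scost_cong)
    fix xs :: "bool list"
    have "conf (Suc t) xs = fstep (tm_delta M) 1 (conf t xs)" by (simp add: conf_def)
    then have "loc (conf (Suc t) xs) i =
       nextloc (tm_delta M) (i = 0) (loc (conf t xs) (i - 1)) (loc (conf t xs) i) (loc (conf t xs) (i + 1))"
      by (simp only: loc_step)
    moreover have "(\<exists>abc \<in> ?I. tbit t (i - 1) (fst abc) xs \<and> (tbit t i (fst (snd abc)) xs \<and> tbit t (i + 1) (snd (snd abc)) xs))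
       \<longleftrightarrow> (loc (conf t xs) (i - 1), loc (conf t xs) i, loc (conf t xs) (i + 1)) \<in> ?I"
      unfolding tbit_def by (rule triple_mem)
    ultimately show "(\<exists>abc \<in> ?I. tbit t (i - 1) (fst abc) xs \<and> (tbit t i (fst (snd abc)) xs \<and> tbit t (i + 1) (snd (snd abc)) xs))
       = tbit (Suc t) i v xs"
      using loc_Val[of t xs] by (simp add: tbit_def)
  qed
qed

lemma scost_bits_Suc: "scost n (K * card Val * step_cost) (tbits t (Suc K)) (tbits (Suc t) K)"
proof -
  have "scost n (card ({..<K} \<times> Val) * step_cost) (tbits t (Suc K)) ((\<lambda>(i, v). tbit (Suc t) i v) ` ({..<K} \<times> Val))"
    by (rule scost_image) (auto simp: finite_Val intro: scost_next)
  then show ?thesis unfolding tbits_def[of "Suc t"] by (simp add: card_cartesian_product)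
qed

lemma scost_bits_run: "scost n (T * ((K + T) * card Val * step_cost)) (tbits 0 (K + T)) (tbits T K)"
proof (induction T arbitrary: K)
  case 0
  then show ?case by (simp add: scost_subset)
next
  case (Suc T)
  have "scost n (T * ((Suc K + T) * card Val * step_cost) + K * card Val * step_cost)
      (tbits 0 (Suc K + T)) (tbits (Suc T) K)"
    by (rule scost_through[OF Suc.IH scost_bits_Suc])
  then have "scost n (T * ((Suc K + T) * card Val * step_cost) + K * card Val * step_cost)
      (tbits 0 (K + Suc T)) (tbits (Suc T) K)" by simp
  then show ?case
  proof (rule scost_mono)
    have "K * card Val * step_cost \<le> (K + Suc T) * card Val * step_cost" by (intro mult_le_mono) auto
    then show "T * ((Suc K + T) * card Val * step_cost) + K * card Val * step_cost
        \<le> Suc T * ((K + Suc T) * card Val * step_cost)" by simp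
  qed auto
qed

lemma scost_bits_0: "scost n (K * card Val * 2) (inputs n) (tbits 0 K)"
proof -
  have "scost n 2 (inputs n) {tbit 0 i v}" if "v \<in> Val" for i v
  proof -
    have loc0: "loc (conf 0 xs) i = (gtape 0 1 2 (u xs) i, if i = 0 then Some 0 else None)" for xs
      by (simp add: conf_def)
    have len: "length xs = n \<Longrightarrow> length (u xs) = U" for xs using u by (simp add: avail_def)
    obtain a h where v: "v = (a, h)" by (cases v) auto
    show ?thesis
    \<comment> \<open>Only in this case does the indicator depend on the input; otherwise it is the
      same for all \<open>xs\<close> of length \<open>n\<close>.\<close>
    proof (cases "h = (if i = 0 then Some 0 else None) \<and> i < U \<and> (a = 1 \<or> a = 2)")
      case True
      then have 1: "scost n 1 (inputs n) {\<lambda>xs. u xs ! i}" using u by (simp add: avail_def)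
      show ?thesis
      proof (cases "a = 2")
        case True': True
        have "scost n 2 (inputs n) {\<lambda>xs. u xs ! i}" using 1 by (rule scost_mono) auto
        then show ?thesis
          by (rule scost_cong) (use True True' len in \<open>auto simp: tbit_def loc0 v gtape_def\<close>)
      next
        case False
        have "scost n 2 (inputs n) {\<lambda>xs. \<not> u xs ! i}" using scost_not[OF 1] by (simp only: one_add_one)
        then show ?thesis
          by (rule scost_cong) (use True False len in \<open>auto simp: tbit_def loc0 v gtape_def\<close>)
      qed
    next
      case False
      have "scost n 2 (inputs n) {\<lambda>xs. h = (if i = 0 then Some 0 else None) \<and> \<not> i < U \<and> a = 0}"
        using scost_const by (rule scost_mono) auto
      then show ?thesis
        by (rule scost_cong) (use False len in \<open>auto simp: tbit_def loc0 v gtape_def\<close>)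
    qed
  qed
  then have "scost n (card ({..<K} \<times> Val) * 2) (inputs n) ((\<lambda>(i, v). tbit 0 i v) ` ({..<K} \<times> Val))"
    by (intro scost_image) (auto simp: finite_Val)
  then show ?thesis unfolding tbits_def by (simp add: card_cartesian_product)
qed

lemma scost_sim: "scost n (sim_cost T K) (inputs n) (tbits T K)"
  unfolding sim_cost_def by (rule scost_through[OF scost_bits_0 scost_bits_run])

lemma scost_cell:
  assumes "i < K" shows "scost n (card Val + 1) (tbits T K) {\<lambda>xs. P (loc (conf T xs) i)}"
proof -
  have "scost n (card {v \<in> Val. P v} * (0 + 1) + 1) (tbits T K) {\<lambda>xs. \<exists>v \<in> {v \<in> Val. P v}. tbit T i v xs}"
    using assms by (intro scost_Bex scost_tbit) (auto simp: finite_Val)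
  moreover have "card {v \<in> Val. P v} \<le> card Val" by (rule card_mono) (auto simp: finite_Val)
  ultimately have "scost n (card Val + 1) (tbits T K) {\<lambda>xs. \<exists>v \<in> {v \<in> Val. P v}. tbit T i v xs}"
    by (elim scost_mono) auto
  then show ?thesis by (rule scost_cong) (auto simp: tbit_def loc_Val)
qed

text \<open>The final head position varies with the input but is at most \<open>T\<close>, hence a
  disjunction over \<open>p\<close>. The word and the cell that ends it lie within the cells up to
  \<open>T + N\<close>.\<close>

lemma scost_fout:
  assumes "length w \<le> N"
  shows "scost n (out_cost T N) (tbits T (Suc T + Suc N)) {\<lambda>xs. fout (conf T xs) w}"
proof -
  have cell: "scost n (card Val + 1) (tbits T (Suc T + Suc N)) {\<lambda>xs. fst (loc (conf T xs) i) = a}"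
    if "i < Suc T + Suc N" for i a
    using scost_cell[OF that, of T "\<lambda>v. fst v = a"] .
  have 1: "scost n (card {..<length w} * (card Val + 1 + 1) + 1) (tbits T (Suc T + Suc N))
     {\<lambda>xs. \<forall>j \<in> {..<length w}. fst (loc (conf T xs) (p + j)) = enc_bit (w ! j)}" if "p < Suc T" for p
    by (intro scost_Ball cell) (use that assms in auto)
  have 1: "scost n (N * (card Val + 1 + 1) + 1) (tbits T (Suc T + Suc N))
     {\<lambda>xs. \<forall>j \<in> {..<length w}. fst (loc (conf T xs) (p + j)) = enc_bit (w ! j)}" if "p < Suc T" for p
    by (rule scost_mono[OF 1[OF that]])
      (use assms in \<open>auto intro!: add_mono mult_le_mono\<close>)
  have "scost n (card {..<Suc T} * ((card Val + 1) + ((N * (card Val + 1 + 1) + 1) + (card Val + 1) + 1) + 1 + 1) + 1)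
     (tbits T (Suc T + Suc N))
     {\<lambda>xs. \<exists>p \<in> {..<Suc T}. snd (loc (conf T xs) p) \<noteq> None \<and>
       ((\<forall>j \<in> {..<length w}. fst (loc (conf T xs) (p + j)) = enc_bit (w ! j)) \<and>
        fst (loc (conf T xs) (p + length w)) \<notin> {1, 2})}"
    using assms
    by (intro scost_Bex scost_and 1 scost_cell[where P = "\<lambda>v. snd v \<noteq> None"] scost_cell[where P = "\<lambda>v. fst v \<notin> {1, 2}"]) auto
  then have "scost n (out_cost T N) (tbits T (Suc T + Suc N))
     {\<lambda>xs. \<exists>p \<in> {..<Suc T}. snd (loc (conf T xs) p) \<noteq> None \<and>
       ((\<forall>j \<in> {..<length w}. fst (loc (conf T xs) (p + j)) = enc_bit (w ! j)) \<and>
        fst (loc (conf T xs) (p + length w)) \<notin> {1, 2})}"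
    by (simp only: out_cost_def card_lessThan)
  then show ?thesis
  proof (rule scost_cong)
    fix xs :: "bool list"
    obtain q h f where c: "conf T xs = (q, h, f)" "h \<le> T" using conf_wf by blast
    show "(\<exists>p \<in> {..<Suc T}. snd (loc (conf T xs) p) \<noteq> None \<and>
       ((\<forall>j \<in> {..<length w}. fst (loc (conf T xs) (p + j)) = enc_bit (w ! j)) \<and>
        fst (loc (conf T xs) (p + length w)) \<notin> {1, 2})) = fout (conf T xs) w"
      using c(2) by (auto simp: c(1))
  qed
qed

end

end

section \<open>Instances with long images\<close>

lemma sim_cost_mono: "K \<le> K' \<Longrightarrow> sim_cost M T K \<le> sim_cost M T K'"
  unfolding sim_cost_def by (intro add_mono mult_le_mono) auto

lemma out_cost_mono: "N \<le> N' \<Longrightarrow> out_cost M T N \<le> out_cost M T N'"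
  unfolding out_cost_def by (intro add_mono mult_le_mono) auto

lemma card_bool_lists: "finite {w :: bool list. length w = n}" "card {w :: bool list. length w = n} = 2 ^ n"
  using finite_lists_length_eq[of "UNIV :: bool set" n] card_lists_length_eq[of "UNIV :: bool set" n] by auto

lemma card_bool_lists_le: "finite {w :: bool list. length w \<le> n}" "card {w :: bool list. length w \<le> n} \<le> 2 ^ (n + 1)"
proof -
  show "finite {w :: bool list. length w \<le> n}"
    using finite_lists_length_le[of "UNIV :: bool set" n] by simp
  have "card {w :: bool list. length w \<le> n} = (\<Sum>i\<le>n. 2 ^ i)"
    using card_lists_length_le[of "UNIV :: bool set" n] by simp
  also have "(\<Sum>i\<le>n. 2 ^ i) \<le> (2::nat) ^ (n + 1)" by (induction n) auto
  finally show "card {w :: bool list. length w \<le> n} \<le> 2 ^ (n + 1)" .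
qed

text \<open>\<open>A\<close> is an arbitrary set: its fewer than \<open>2 ^ (N + 1)\<close> strings
  of length at most \<open>N\<close> are hardwired. The simulation of \<open>M\<close> is shared by
  all comparisons.\<close>

lemma circuit_query:
  assumes wf: "wf_tm M" and run: "\<And>x. \<exists>t. t \<le> c * length x ^ k + c \<and> halts_with M x t (f x)"
  shows "\<exists>q. polybd q \<and> (\<forall>n U u N A. avail n U u \<longrightarrow> N \<le> U \<longrightarrow>
     scost n (2 ^ (N + 1) * q U) (inputs n) {\<lambda>xs. length (f (u xs)) \<le> N \<and> f (u xs) \<in> A})"
proof -
  define T where "T U = c * U ^ k + c" for U
  \<comment> \<open>By \<open>N \<le> U\<close>, \<open>U\<close> may replace \<open>N\<close> in
    both costs; the 2 pays for the disjunction over the short strings.\<close>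
  define q where "q U = sim_cost M (T U) (Suc (T U) + Suc U) + out_cost M (T U) U + 2" for U
  have "polybd T" unfolding T_def by (rule polybd_sum2)
  then have "polybd q" unfolding q_def sim_cost_def out_cost_def
    by (intro polybd_add polybd_mult polybd_const polybd_id polybd_Suc_fun)
  moreover have "scost n (2 ^ (N + 1) * q U) (inputs n) {\<lambda>xs. length (f (u xs)) \<le> N \<and> f (u xs) \<in> A}"
    if u: "avail n U u" and N: "N \<le> U" for n U u N A
  proof -
    let ?T = "T U" and ?I = "{w. length w \<le> N \<and> w \<in> A}"
    have fin: "finite ?I" by (rule finite_subset[OF _ card_bool_lists_le(1)[of N]]) auto
    have "card ?I \<le> card {w :: bool list. length w \<le> N}" by (rule card_mono[OF card_bool_lists_le(1)]) auto
    then have card: "card ?I \<le> 2 ^ (N + 1)" using card_bool_lists_le(2)[of N] by linarith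
    have "scost n (card ?I * (out_cost M ?T N + 1) + 1) (tbits M u ?T (Suc ?T + Suc N)) {\<lambda>xs. \<exists>w \<in> ?I. fout (conf M u ?T xs) w}"
      by (intro scost_Bex fin scost_fout[OF wf u]) auto
    from scost_through[OF scost_sim[OF wf u] this]
    have "scost n (sim_cost M ?T (Suc ?T + Suc N) + (card ?I * (out_cost M ?T N + 1) + 1)) (inputs n)
       {\<lambda>xs. \<exists>w \<in> ?I. fout (conf M u ?T xs) w}" .
    then have "scost n (2 ^ (N + 1) * q U) (inputs n) {\<lambda>xs. \<exists>w \<in> ?I. fout (conf M u ?T xs) w}"
    proof (rule scost_mono)
      let ?s = "sim_cost M ?T (Suc ?T + Suc U)" and ?o = "out_cost M ?T U"
      have le: "sim_cost M ?T (Suc ?T + Suc N) \<le> ?s" "out_cost M ?T N \<le> ?o"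
        using N by (auto intro!: sim_cost_mono out_cost_mono)
      have "1 * (sim_cost M ?T (Suc ?T + Suc N) + 1) \<le> 2 ^ (N + 1) * (?s + 1)"
        using le(1) by (intro mult_le_mono) auto
      moreover have "card ?I * (out_cost M ?T N + 1) \<le> 2 ^ (N + 1) * (?o + 1)"
        using card le(2) by (intro mult_le_mono) auto
      ultimately have "1 * (sim_cost M ?T (Suc ?T + Suc N) + 1) + card ?I * (out_cost M ?T N + 1)
         \<le> 2 ^ (N + 1) * (?s + 1) + 2 ^ (N + 1) * (?o + 1)" by (rule add_mono)
      then have "sim_cost M ?T (Suc ?T + Suc N) + (card ?I * (out_cost M ?T N + 1) + 1)
         \<le> 2 ^ (N + 1) * (?s + 1) + 2 ^ (N + 1) * (?o + 1)" by (simp only: ac_simps mult_1)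
      also have "\<dots> = 2 ^ (N + 1) * q U" by (simp add: q_def algebra_simps)
      finally show "sim_cost M ?T (Suc ?T + Suc N) + (card ?I * (out_cost M ?T N + 1) + 1) \<le> 2 ^ (N + 1) * q U" .
    qed auto
    then show ?thesis
    proof (rule scost_cong)
      fix xs :: "bool list" assume "length xs = n"
      then have len: "length (u xs) = U" using u by (simp add: avail_def)
      obtain t where t: "t \<le> ?T" "halts_with M (u xs) t (f (u xs))"
        using run[of "u xs"] len by (auto simp: T_def)
      from t(2) obtain h g where "(fstep (tm_delta M) 1 ^^ t) (0, 0, gtape 0 1 2 (u xs)) = (1, h, g)"
        "fout (1::nat, h, g) (f (u xs))" unfolding halts_with_iff by blast
      with fstep_halted_later[OF this(1) t(1)] have "halts_with M (u xs) ?T (f (u xs))"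
        unfolding halts_with_iff by blast
      then have "tm_output ((tm_step M ^^ ?T) (tm_init (u xs))) = f (u xs)" by (simp add: halts_with_def)
      then have "fout (conf M u ?T xs) w \<longleftrightarrow> f (u xs) = w" for w
        unfolding conf_def abs_conf_init[symmetric] abs_conf_steps[symmetric] tm_output_iff[symmetric] by simp
      then show "(\<exists>w \<in> ?I. fout (conf M u ?T xs) w) \<longleftrightarrow> (length (f (u xs)) \<le> N \<and> f (u xs) \<in> A)" by auto
    qed
  qed
  ultimately show ?thesis by blast
qed

text \<open>The total is at most \<open>2 ^ (4 * r + 1)\<close>, and
  \<open>4 * r + 1 \<le> r\<^sup>2\<close> holds from \<open>r = 5\<close> on. One gate is held back
  for a final negation.\<close>

lemma scost_search:
  assumes "finite I" "card I \<le> 2 ^ (2 * r)" "N \<le> r" "5 \<le> r" "q + 1 \<le> 2 ^ r"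
    and "\<And>i. i \<in> I \<Longrightarrow> scost m (2 ^ (N + 1) * q) (inputs m) {g i}"
  shows "scost m (2 ^ r\<^sup>2 - 1) (inputs m) {\<lambda>xs. \<exists>i \<in> I. g i xs}"
proof (rule scost_mono[OF scost_Bex[OF assms(1,6)]])
  have "2 ^ (N + 1) * q + 1 \<le> 2 ^ (r + 1) * q + 1"
    using assms(3) by (intro add_mono mult_le_mono power_increasing) auto
  then have "card I * (2 ^ (N + 1) * q + 1) \<le> 2 ^ (2 * r) * (2 ^ (r + 1) * q + 1)"
    by (rule mult_le_mono[OF assms(2)])
  also have "2 ^ (2 * r) * (2 ^ (r + 1) * q + 1) + 2 \<le> 2 ^ (2 * r) * (2 ^ (r + 1) * (q + 1))"
  proof -
    have "2 ^ 1 \<le> (2::nat) ^ (2 * r)" "2 ^ 1 \<le> (2::nat) ^ (r + 1)" using assms(4) by (intro power_increasing; simp)+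
    then have "2 ^ (2 * r) * 1 + 2 \<le> (2::nat) ^ (2 * r) * 2" "2 ^ (2 * r) * 2 \<le> (2::nat) ^ (2 * r) * 2 ^ (r + 1)"
      by (simp, intro mult_le_mono2) simp
    then have "2 ^ (2 * r) * 1 + 2 \<le> (2::nat) ^ (2 * r) * 2 ^ (r + 1)" by linarith
    then show ?thesis unfolding distrib_left by linarith
  qed
  finally have "card I * (2 ^ (N + 1) * q + 1) + 2 \<le> 2 ^ (2 * r) * (2 ^ (r + 1) * (q + 1))" by simp
  also have "\<dots> \<le> 2 ^ (2 * r) * (2 ^ (r + 1) * 2 ^ r)" using assms(5) by (intro mult_le_mono order_refl)
  also have "\<dots> = 2 ^ (4 * r + 1)" by (simp add: power_add[symmetric])
  also have "\<dots> \<le> 2 ^ r\<^sup>2"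
  proof (rule power_increasing)
    have "5 * r \<le> r * r" using assms(4) by (intro mult_le_mono1)
    then show "4 * r + 1 \<le> r\<^sup>2" using assms(4) unfolding power2_eq_square by linarith
  qed simp
  finally show "card I * (2 ^ (N + 1) * q + 1) + 1 \<le> 2 ^ r\<^sup>2 - 1" by simp
qed auto

section \<open>Growth rates and the hardness hypothesis\<close>

lemma polybd_le_exp:
  assumes "polybd p" shows "\<exists>n0. \<forall>n \<ge> n0. p n \<le> 2 ^ n"
proof -
  obtain c k where p: "\<And>n. p n \<le> c * Suc n ^ k" using assms unfolding polybd_Suc by blast
  let ?d = "Suc k"
  \<comment> \<open>With \<open>m = n div (k + 1)\<close> one has
    \<open>2 ^ n \<ge> (2 ^ m) ^ (k + 1) \<ge> m * m ^ k\<close>. The spare factor \<open>m\<close>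
    absorbs the constant once \<open>m \<ge> b\<close>.\<close>
  define b where "b = c * (2 * ?d) ^ k + 1"
  have "p n \<le> 2 ^ n" if n: "?d * b \<le> n" for n
  proof -
    define m where "m = n div ?d"
    have m: "b \<le> m" using n unfolding m_def by (simp add: less_eq_div_iff_mult_less_eq mult.commute)
    have dm: "?d * m \<le> n" unfolding m_def by (rule times_div_less_eq_dividend)
    have "n < ?d * Suc m" using dividend_less_times_div[of ?d n] by (simp add: m_def)
    moreover have "?d * Suc m \<le> ?d * (2 * m)" using m by (intro mult_le_mono2) (simp add: b_def)
    ultimately have "Suc n \<le> (2 * ?d) * m" by (simp add: ac_simps)
    then have "Suc n ^ k \<le> ((2 * ?d) * m) ^ k" by (rule power_mono) simp
    then have "c * Suc n ^ k \<le> c * ((2 * ?d) ^ k * m ^ k)"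
      by (intro mult_le_mono2) (simp only: power_mult_distrib)
    also have "\<dots> = (c * (2 * ?d) ^ k) * m ^ k" by (simp only: mult.assoc)
    also have "\<dots> \<le> m * m ^ k" using m by (intro mult_le_mono1) (simp add: b_def)
    also have "\<dots> = m ^ ?d" by simp
    also have "\<dots> \<le> (2 ^ m) ^ ?d" by (rule power_mono) (auto intro: less_imp_le less_exp)
    also have "\<dots> = 2 ^ (?d * m)" by (simp only: power_mult[symmetric] mult.commute)
    also have "\<dots> \<le> 2 ^ n" using dm by (intro power_increasing) auto
    finally show ?thesis using p[of n] by linarith
  qed
  then show ?thesis by blast
qed

text \<open>For \<open>k \<ge> 2 / \<epsilon>\<close> the exponent
  \<open>(N ^ k) powr \<epsilon>\<close> is at least \<open>N\<^sup>2\<close>, which beats a search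
  of cost \<open>2 ^ O(N)\<close>.\<close>

lemma hard_at_powers:
  assumes "\<epsilon> > (0::real)" "\<forall>\<^sub>F n in sequentially. real (CC n (lang_slice L n)) > 2 powr (real n powr \<epsilon>)"
  shows "\<exists>k N0. 1 \<le> k \<and> (\<forall>N \<ge> N0. 2 ^ N\<^sup>2 < CC (N ^ k) (lang_slice L (N ^ k)))"
proof -
  obtain n0 where n0: "\<And>n. n0 \<le> n \<Longrightarrow> real (CC n (lang_slice L n)) > 2 powr (real n powr \<epsilon>)"
    using assms(2) unfolding eventually_sequentially by blast
  \<comment> \<open>The maximum with 1 gives \<open>N \<le> N ^ k\<close>, so the threshold
    \<open>n0\<close> carries over from lengths to \<open>N\<close>.\<close>
  define k where "k = max 1 (nat \<lceil>2 / \<epsilon>\<rceil>)"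
  have "2 / \<epsilon> \<le> real k" unfolding k_def by linarith
  then have k: "2 \<le> real k * \<epsilon>" using assms(1) by (simp add: field_simps)
  have "2 ^ N\<^sup>2 < CC (N ^ k) (lang_slice L (N ^ k))" if "max 1 n0 \<le> N" for N
  proof -
    have N: "1 \<le> N" "n0 \<le> N" using that by auto
    have "N ^ 1 \<le> N ^ k" using N by (intro power_increasing) (auto simp: k_def)
    then have "n0 \<le> N ^ k" using N by simp
    then have c: "2 powr (real (N ^ k) powr \<epsilon>) < real (CC (N ^ k) (lang_slice L (N ^ k)))"
      by (rule n0)
    have "real (N ^ k) powr \<epsilon> = (real N powr real k) powr \<epsilon>" using N by (simp add: powr_realpow)
    also have "\<dots> = real N powr (real k * \<epsilon>)" by (simp add: powr_powr)
    finally have "real (N ^ k) powr \<epsilon> = real N powr (real k * \<epsilon>)" .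
    moreover have "real N powr 2 \<le> real N powr (real k * \<epsilon>)" by (rule powr_mono[OF k]) (use N in simp)
    ultimately have "real N powr 2 \<le> real (N ^ k) powr \<epsilon>" by simp
    then have "real (N\<^sup>2) \<le> real (N ^ k) powr \<epsilon>" using N by simp
    then have "2 powr real (N\<^sup>2) \<le> 2 powr (real (N ^ k) powr \<epsilon>)" by (intro powr_mono) auto
    also note c
    also have "2 powr real (N\<^sup>2) = real (2 ^ N\<^sup>2)" by (subst powr_realpow) simp_all
    finally show ?thesis by (simp only: of_nat_less_iff)
  qed
  then show ?thesis by (intro exI[of _ k] exI[of _ "max 1 n0"]) (simp add: k_def)
qed

section \<open>Instances of the combined language and the two searches\<close>

definition inst :: "(nat \<Rightarrow> nat) \<Rightarrow> (nat \<Rightarrow> nat) \<Rightarrow> bool list \<Rightarrow> bool list \<Rightarrow> bool list \<Rightarrow> bool list" where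
  "inst p r y x z = enc_fields [y, x, z, replicate (p (length y)) False,
     replicate (r (length x)) False, replicate (r (length z)) False]"

definition inst_len :: "(nat \<Rightarrow> nat) \<Rightarrow> (nat \<Rightarrow> nat) \<Rightarrow> nat \<Rightarrow> nat \<Rightarrow> nat \<Rightarrow> nat" where
  "inst_len p r n m1 m2 = 2 * (n + m1 + m2 + p n + r m1 + r m2) + 12"

lemma avail_inst:
  assumes "avail n a y" "avail n b x" "avail n c z"
  shows "avail n (inst_len p r a b c) (\<lambda>xs. inst p r (y xs) (x xs) (z xs))"
proof -
  have len: "length (y xs) = a" "length (x xs) = b" "length (z xs) = c" if "length xs = n" for xs
    using assms that by (auto simp: avail_def)
  have rep: "avail n m (\<lambda>xs. replicate m False)" for m
    using avail_const[of n "replicate m False"] by simp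
  have nil: "avail n 0 (\<lambda>xs. [])" using avail_const[of n "[]"] by simp
  have eq: "2 * a + (2 + (2 * b + (2 + (2 * c + (2 + (2 * p a + (2 + (2 * r b + (2 + (2 * r c + (2 + 0)))))))))))
      = inst_len p r a b c" by (simp add: inst_len_def)
  have av: "avail n (inst_len p r a b c) (\<lambda>xs. enc_fields [y xs, x xs, z xs,
      replicate (p a) False, replicate (r b) False, replicate (r c) False])"
    unfolding enc_fields_simps eq[symmetric] by (intro avail_field assms rep nil)
  show ?thesis unfolding avail_def
  proof (intro conjI allI impI)
    show "length (inst p r (y xs) (x xs) (z xs)) = inst_len p r a b c" if "length xs = n" for xs
      by (simp add: inst_def inst_len_def len[OF that])
    fix i assume "i < inst_len p r a b c"
    with av have "scost n 1 (inputs n) {\<lambda>xs. enc_fields [y xs, x xs, z xs,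
      replicate (p a) False, replicate (r b) False, replicate (r c) False] ! i}" unfolding avail_def by blast
    then show "scost n 1 (inputs n) {\<lambda>xs. inst p r (y xs) (x xs) (z xs) ! i}"
      by (rule scost_cong) (simp add: inst_def len del: enc_fields_simps)
  qed
qed

lemma search_contradiction:
  assumes "\<And>xs. length xs = m \<Longrightarrow> (\<exists>i \<in> I. g i xs) \<longleftrightarrow> (xs \<in> L) \<noteq> neg"
    and "2 ^ r\<^sup>2 < CC m (lang_slice L m)"
    and "scost m (2 ^ r\<^sup>2 - 1) (inputs m) {\<lambda>xs. \<exists>i \<in> I. g i xs}"
  shows False
proof -
  have "scost m (2 ^ r\<^sup>2 - 1 + 1) (inputs m) {lang_slice L m}"
  proof (cases neg)
    case True
    show ?thesis by (rule scost_cong[OF scost_not[OF assms(3)]]) (use assms(1) True in \<open>auto simp: lang_slice_def\<close>)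
  next
    case False
    have "scost m (2 ^ r\<^sup>2 - 1 + 1) (inputs m) {\<lambda>xs. \<exists>i \<in> I. g i xs}"
      by (rule scost_mono[OF assms(3)]) auto
    then show ?thesis by (rule scost_cong) (use assms(1) False in \<open>auto simp: lang_slice_def\<close>)
  qed
  from CC_le[OF this] show False using assms(2) by simp
qed

lemma long_images:
  assumes red: "\<And>y x z. (y \<in> B \<and> x \<in> L) \<or> z \<in> L \<longleftrightarrow> f (inst p r y x z) \<in> A"
    and query: "\<And>n U u N A. avail n U u \<Longrightarrow> N \<le> U \<Longrightarrow>
      scost n (2 ^ (N + 1) * q U) (inputs n) {\<lambda>xs. length (f (u xs)) \<le> N \<and> f (u xs) \<in> A}"
    and n: "n \<le> N" "N \<le> m1" "5 \<le> N"
    and hard: "2 ^ m1\<^sup>2 < CC m2 (lang_slice L m2)" "2 ^ N\<^sup>2 < CC m1 (lang_slice L m1)"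
    and q: "q (inst_len p r n m1 m2) + 1 \<le> 2 ^ N"
  shows "\<exists>x z. length x = m1 \<and> length z = m2 \<and> x \<in> L \<and> z \<notin> L \<and>
     (\<forall>y. length y = n \<longrightarrow> N < length (f (inst p r y x z)))"
proof -
  let ?U = "inst_len p r n m1 m2"
  have NU: "N \<le> ?U" using n by (simp add: inst_len_def)
  \<comment> \<open>The search for \<open>z\<close> has parameter \<open>m1\<close>, the one for
    \<open>x\<close> has parameter \<open>N\<close>.\<close>
  have qm: "q ?U + 1 \<le> 2 ^ m1" using q n(2) by (meson le_trans one_le_numeral power_increasing)
  obtain z where z: "length z = m2" "z \<notin> L"
    "\<And>x y. length x = m1 \<Longrightarrow> x \<in> L \<Longrightarrow> length y = n \<Longrightarrow> y \<notin> B \<Longrightarrow> N < length (f (inst p r y x z))"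
  proof (rule ccontr)
    note found = that
    assume no: "\<not> thesis"
    define I where "I = {x \<in> {x. length x = m1}. x \<in> L} \<times> {y \<in> {y. length y = n}. y \<notin> B}"
    \<comment> \<open>Here \<open>x\<close> and \<open>y\<close> are hardwired and \<open>z\<close>
      is the input. The query concerns the complement of \<open>A\<close>, which is possible because
      \<open>query\<close> holds for every set.\<close>
    let ?g = "\<lambda>(x, y) z. length (f (inst p r y x z)) \<le> N \<and> f (inst p r y x z) \<in> - A"
    show False
    proof (rule search_contradiction[where neg = True, OF _ hard(1)])
      fix z :: "bool list" assume z: "length z = m2"
      show "(\<exists>i \<in> I. ?g i z) \<longleftrightarrow> (z \<in> L) \<noteq> True"
      proof
        assume "\<exists>i \<in> I. ?g i z"
        then show "(z \<in> L) \<noteq> True" using red by fastforce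
      next
        assume "(z \<in> L) \<noteq> True"
        then obtain x y where xy: "length x = m1" "x \<in> L" "length y = n" "y \<notin> B" "length (f (inst p r y x z)) \<le> N"
          using no found[OF z] by (meson linorder_not_le)
        then have "f (inst p r y x z) \<in> - A" using red[of y x z] \<open>(z \<in> L) \<noteq> True\<close> by auto
        then show "\<exists>i \<in> I. ?g i z" using xy by (intro bexI[of _ "(x, y)"]) (auto simp: I_def)
      qed
    next
      have "card I \<le> 2 ^ m1 * 2 ^ n"
        unfolding I_def card_cartesian_product card_bool_lists(2)[symmetric]
        by (intro mult_le_mono card_mono card_bool_lists) auto
      also have "\<dots> \<le> 2 ^ (2 * m1)"
        using n unfolding power_add[symmetric] by (intro power_increasing) auto
      finally have card: "card I \<le> 2 ^ (2 * m1)" .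
      have "scost m2 (2 ^ (N + 1) * q ?U) (inputs m2) {?g i}" if iI: "i \<in> I" for i
      proof -
        obtain x y where i: "i = (x, y)" "length x = m1" "length y = n" using iI by (auto simp: I_def)
        have "avail m2 ?U (\<lambda>z. inst p r y x z)"
          using avail_inst[OF avail_const[of m2 y] avail_const[of m2 x] avail_id] i by simp
        from query[OF this NU, of "- A"] show ?thesis by (simp add: i)
      qed
      then show "scost m2 (2 ^ m1\<^sup>2 - 1) (inputs m2) {\<lambda>xs. \<exists>i \<in> I. ?g i xs}"
        using n card qm by (intro scost_search[where N = N and q = "q ?U"]) (auto simp: I_def card_bool_lists)
    qed
  qed
  obtain x where x: "length x = m1" "x \<in> L"
    "\<And>y. length y = n \<Longrightarrow> y \<in> B \<Longrightarrow> N < length (f (inst p r y x z))"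
  proof (rule ccontr)
    note found = that
    assume no: "\<not> thesis"
    define I where "I = {y \<in> {y. length y = n}. y \<in> B}"
    \<comment> \<open>Now \<open>y\<close> and \<open>z\<close> are hardwired and \<open>x\<close>
      is the input. Since \<open>z \<notin> L\<close>, an image in \<open>A\<close> can only come
      from \<open>x \<in> L\<close>.\<close>
    let ?g = "\<lambda>y x. length (f (inst p r y x z)) \<le> N \<and> f (inst p r y x z) \<in> A"
    show False
    proof (rule search_contradiction[where neg = False, OF _ hard(2)])
      fix x :: "bool list" assume x: "length x = m1"
      show "(\<exists>i \<in> I. ?g i x) \<longleftrightarrow> (x \<in> L) \<noteq> False"
      proof
        assume "\<exists>i \<in> I. ?g i x"
        then show "(x \<in> L) \<noteq> False" using red z(2) by fastforce
      next
        assume "(x \<in> L) \<noteq> False"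
        then obtain y where y: "length y = n" "y \<in> B" "length (f (inst p r y x z)) \<le> N"
          using no found[OF x] by (meson linorder_not_le)
        then have "f (inst p r y x z) \<in> A" using red[of y x z] \<open>(x \<in> L) \<noteq> False\<close> by auto
        then show "\<exists>i \<in> I. ?g i x" using y by (auto simp: I_def)
      qed
    next
      have "card I \<le> 2 ^ n"
        unfolding I_def card_bool_lists(2)[symmetric] by (intro card_mono card_bool_lists) auto
      also have "\<dots> \<le> 2 ^ (2 * N)" using n by (intro power_increasing) auto
      finally have card: "card I \<le> 2 ^ (2 * N)" .
      have "scost m1 (2 ^ (N + 1) * q ?U) (inputs m1) {?g y}" if "y \<in> I" for y
      proof -
        have "length y = n" using that by (simp add: I_def)
        then have "avail m1 ?U (\<lambda>x. inst p r y x z)"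
          using avail_inst[OF avail_const[of m1 y] avail_id avail_const[of m1 z]] z(1) by simp
        from query[OF this NU] show ?thesis .
      qed
      then show "scost m1 (2 ^ N\<^sup>2 - 1) (inputs m1) {\<lambda>xs. \<exists>i \<in> I. ?g i xs}"
        using n card q by (intro scost_search[where N = N and q = "q ?U"]) (auto simp: I_def card_bool_lists)
    qed
  qed
  show ?thesis using x z by blast
qed

theorem theorem3p1:
  assumes "\<exists>L \<epsilon>. in_NP L \<and> \<epsilon> > (0::real) \<and>
             (\<forall>\<^sub>F n in sequentially. real (CC n (lang_slice L n)) > 2 powr (real n powr \<epsilon>))"
  shows "\<forall>A. NP_complete A \<longrightarrow>
           (\<forall>B. in_NP B \<longrightarrow>
              (\<exists>f. P_poly_computable f \<and> (\<forall>x. x \<in> B \<longleftrightarrow> f x \<in> A) \<and>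
                   (\<forall>x. length (f x) > length x)))"
proof (intro allI impI)
  fix A B assume A: "NP_complete A" and B: "in_NP B"
  obtain L \<epsilon> where L: "in_NP L" "\<epsilon> > (0::real)"
    "\<forall>\<^sub>F n in sequentially. real (CC n (lang_slice L n)) > 2 powr (real n powr \<epsilon>)"
    using assms by blast
  obtain C c k d l where C: "in_NP C" and
    comb: "\<And>y x z. enc_fields [y, x, z, replicate (c * length y ^ k + c) False,
      replicate (d * length x ^ l + d) False, replicate (d * length z ^ l + d) False] \<in> C
      \<longleftrightarrow> (y \<in> B \<and> x \<in> L) \<or> z \<in> L"
    using in_NP_combine[OF B L(1)] by blast
  define p where "p n = c * n ^ k + c" for n
  define r where "r n = d * n ^ l + d" for n
  obtain f where f: "poly_time_computable f" "\<And>u. u \<in> C \<longleftrightarrow> f u \<in> A"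
    using A C unfolding NP_complete_def by blast
  have red: "(y \<in> B \<and> x \<in> L) \<or> z \<in> L \<longleftrightarrow> f (inst p r y x z) \<in> A" for y x z
    using comb[of y x z] f(2) unfolding inst_def p_def r_def by blast
  obtain M cf kf where M: "wf_tm M" "\<And>x. \<exists>t. t \<le> cf * length x ^ kf + cf \<and> halts_with M x t (f x)"
    using f(1) unfolding poly_time_computable_def by blast
  obtain q where q: "polybd q" and query: "\<And>n U u N A. avail n U u \<Longrightarrow> N \<le> U \<Longrightarrow>
     scost n (2 ^ (N + 1) * q U) (inputs n) {\<lambda>xs. length (f (u xs)) \<le> N \<and> f (u xs) \<in> A}"
    using circuit_query[where f = f, OF M] by blast
  obtain cq kq where cq: "\<And>n. q n \<le> cq * n ^ kq + cq" using q unfolding polybd_def by blast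
  obtain e N0 where e: "1 \<le> e" "\<And>N. N0 \<le> N \<Longrightarrow> 2 ^ N\<^sup>2 < CC (N ^ e) (lang_slice L (N ^ e))"
    using hard_at_powers[OF L(2,3)] by blast
  \<comment> \<open>Bounds the instance length by a polynomial in \<open>s = N n\<close> alone, to
    be compared with \<open>2 ^ s\<close>.\<close>
  define W where "W s = 2 * (s + s ^ e + (s ^ e) ^ e + p s + r (s ^ e) + r ((s ^ e) ^ e)) + 12" for s
  have bd: "polybd p" "polybd (\<lambda>n. r (g n))" if "polybd g" for g
    using that unfolding p_def r_def by (intro polybd_add polybd_mult polybd_power polybd_const polybd_id | assumption)+
  have "polybd (\<lambda>s. cq * W s ^ kq + cq + 1)"
    unfolding W_def by (intro polybd_add polybd_mult polybd_power polybd_const polybd_id bd[OF polybd_id] bd)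
  then obtain n1 where n1: "\<And>s. n1 \<le> s \<Longrightarrow> cq * W s ^ kq + cq + 1 \<le> 2 ^ s"
    using polybd_le_exp by blast
  \<comment> \<open>Collects the thresholds: 5 for \<open>scost_search\<close>, \<open>N0\<close>
    for hardness, \<open>n1\<close> for growth. Taking \<open>max n b\<close> treats the finitely
    many short input lengths like all others.\<close>
  define b where "b = max 5 (max N0 n1)"
  define N where "N n = max n b" for n
  have N: "n \<le> N n" "5 \<le> N n" "N0 \<le> N n" "n1 \<le> N n" "N n \<le> n + b" for n by (auto simp: N_def b_def)
  have Ne: "N n \<le> N n ^ e" for n
    using power_increasing[OF e(1), of "N n"] N(2)[of n] by simp
  have "\<exists>x z. length x = N n ^ e \<and> length z = (N n ^ e) ^ e \<and> x \<in> L \<and> z \<notin> L \<and>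
     (\<forall>y. length y = n \<longrightarrow> N n < length (f (inst p r y x z)))" for n
  proof (rule long_images[OF red query N(1) Ne N(2)])
    show "2 ^ (N n ^ e)\<^sup>2 < CC ((N n ^ e) ^ e) (lang_slice L ((N n ^ e) ^ e))"
      using e(2)[of "N n ^ e"] N(3)[of n] Ne[of n] by simp
    show "2 ^ (N n)\<^sup>2 < CC (N n ^ e) (lang_slice L (N n ^ e))" using e(2) N(3) by blast
    have "p n \<le> p (N n)" unfolding p_def using N(1) by (intro add_mono mult_le_mono power_mono) auto
    then have "inst_len p r n (N n ^ e) ((N n ^ e) ^ e) \<le> W (N n)"
      using N(1)[of n] unfolding inst_len_def W_def by (intro add_mono mult_le_mono order_refl)
    then have "cq * inst_len p r n (N n ^ e) ((N n ^ e) ^ e) ^ kq + cq + 1 \<le> cq * W (N n) ^ kq + cq + 1"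
      by (intro add_mono mult_le_mono power_mono) auto
    then show "q (inst_len p r n (N n ^ e) ((N n ^ e) ^ e)) + 1 \<le> 2 ^ N n"
      using cq[of "inst_len p r n (N n ^ e) ((N n ^ e) ^ e)"] n1[OF N(4)[of n]] by linarith
  qed
  then obtain X Z where XZ: "\<And>n. length (X n) = N n ^ e" "\<And>n. length (Z n) = (N n ^ e) ^ e"
    "\<And>n. X n \<in> L" "\<And>n. Z n \<notin> L" "\<And>y. N (length y) < length (f (inst p r y (X (length y)) (Z (length y))))"
    by metis
  \<comment> \<open>The instance without its first field, so that
    \<open>pair_enc y (a (length y))\<close> is the instance and \<open>M\<close> runs on it
    directly.\<close>
  define a where "a n = enc_fields [X n, Z n, replicate (p n) False, replicate (r (length (X n))) False,
     replicate (r (length (Z n))) False]" for n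
  define h where "h y = f (pair_enc y (a (length y)))" for y
  have h: "h y = f (inst p r y (X (length y)) (Z (length y)))" for y
    by (simp add: h_def inst_def a_def pair_enc_dbl)
  \<comment> \<open>\<open>N n\<close> is replaced by \<open>n + b\<close>, to which the closure
    rules of \<open>polybd\<close> apply.\<close>
  define s where "s n = 2 * ((n + b) ^ e + ((n + b) ^ e) ^ e + p n + r ((n + b) ^ e) + r (((n + b) ^ e) ^ e)) + 10" for n
  have la: "length (a n) \<le> s n" for n
  proof -
    have 1: "N n ^ e \<le> (n + b) ^ e" using N(5) by (rule power_mono) simp
    then have 2: "(N n ^ e) ^ e \<le> ((n + b) ^ e) ^ e" by (rule power_mono) simp
    have "r i \<le> r j" if "i \<le> j" for i j
      unfolding r_def using that by (intro add_mono mult_le_mono power_mono) auto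
    note r = this[OF 1] this[OF 2]
    have "length (a n) = 2 * (N n ^ e + (N n ^ e) ^ e + p n + r (N n ^ e) + r ((N n ^ e) ^ e)) + 10"
      by (simp add: a_def XZ(1,2))
    also have "\<dots> \<le> s n"
      using 1 2 r unfolding s_def by (intro add_mono mult_le_mono order_refl)
    finally show ?thesis .
  qed
  have ps: "polybd s"
    unfolding s_def by (intro polybd_add polybd_mult polybd_power polybd_const polybd_id bd[OF polybd_id] bd)
  \<comment> \<open>Advice length and running time are bounded together, as
    \<open>P_poly_computable\<close> uses the same constants for both.\<close>
  have "polybd (\<lambda>n. s n + (cf * (2 * n + 2 + s n) ^ kf + cf))"
    by (intro polybd_add polybd_mult polybd_power polybd_const polybd_id ps)
  then obtain c' k' where c': "\<And>n. s n + (cf * (2 * n + 2 + s n) ^ kf + cf) \<le> c' * n ^ k' + c'"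
    unfolding polybd_def by blast
  have "length (a n) \<le> c' * n ^ k' + c'" for n using la[of n] c'[of n] by linarith
  moreover have "\<exists>t. t \<le> c' * length x ^ k' + c' \<and> halts_with M (pair_enc x (a (length x))) t (h x)" for x
  proof -
    obtain t where t: "t \<le> cf * length (pair_enc x (a (length x))) ^ kf + cf"
      "halts_with M (pair_enc x (a (length x))) t (h x)" using M(2) unfolding h_def by blast
    have "length (pair_enc x (a (length x))) \<le> 2 * length x + 2 + s (length x)"
      using la[of "length x"] by (simp add: pair_enc_dbl)
    then have "cf * length (pair_enc x (a (length x))) ^ kf + cf \<le> cf * (2 * length x + 2 + s (length x)) ^ kf + cf"
      by (intro add_mono mult_le_mono power_mono) auto
    then have "t \<le> c' * length x ^ k' + c'" using t(1) c'[of "length x"] by linarith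
    then show ?thesis using t(2) by blast
  qed
  ultimately have "P_poly_computable h" unfolding P_poly_computable_def using M(1) by blast
  moreover have "\<forall>x. x \<in> B \<longleftrightarrow> h x \<in> A" unfolding h red[symmetric] using XZ(3,4) by blast
  moreover have "\<forall>x. length (h x) > length x" unfolding h using XZ(5) N(1) le_less_trans by blast
  ultimately show "\<exists>f. P_poly_computable f \<and> (\<forall>x. x \<in> B \<longleftrightarrow> f x \<in> A) \<and> (\<forall>x. length (f x) > length x)"
    by blast
qed

end
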